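(* Let $X\subset\mathbb{N}$ satisfy $\overline{\mu}(X+X)<2\overline{\mu}(X)$. Then there exist a positive integer $q$ and a periodic set $A=\bigcup_{j=1}^{r}(a_j+q\mathbb{N})\in\mathcal{Z}$ such that: <ol> <li>$q$ is minimal and $\overline{A}^{(q)}+\overline{A}^{(q)}$ is not periodic in $\mathbb{Z}/q\mathbb{Z}$;</li> <li>$X\subset A$, $\overline{X}^{(q)}=\overline{A}^{(q)}$, $|\overline{X}^{(q)}|=r\ge1$, and $|\overline{X}^{(q)}+\overline{X}^{(q)}|=2r-1$;</li> <li>if $r=1$ then $\overline{X}^{(q)}=\{\overline{a}\}$ and $\overline{X}^{(q)}+\overline{X}^{(q)}=\{2\overline{a}\}$ for some $\overline{a}\in\mathbb{Z}/q\mathbb{Z}$;</li> <li>if $r\ge2$ then $\overline{X}^{(q)}+\overline{X}^{(q)}$ is either quasi-periodic, or a non quasi-periodic arithmetic progression in $\mathbb{Z}/q\mathbb{Z}$, in which case $\overline{X}^{(q)}$ is also an arithmetic progression in $\mathbb{Z}/q\mathbb{Z}$;</li> <li>for every integer $m\ge1$ and all triples $(i,j,h)\in\{1,\dots,r\}^2\times\{0,\dots,m-1\}$, the set $(a_i+a_j+hq+mq\mathbb{N})\cap(X+X)$ is infinite;</li> <li>$\overline{\mu}(X+X)=\frac{2r-1}{q}$ and $\frac rq-\frac1{2q}<\overline{\mu}(X)\le\frac rq$.</li> </ol>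
   Context: $\mathbb{N}=\{0,1,2,\dots\}$. For $A,B\subset\mathbb{Z}$, $A+B=\{a+b: a\in A,b\in B\}$ and $c\mathbb{N}=\{cn:n\in\mathbb{N}\}$. Let $\mathcal{Z}$ be the family of all finite unions $\bigcup_{i=1}^r(a_i+k_i\mathbb{N})$ with $r,a_i,k_i\in\mathbb{N}$; each $A\in\mathcal{Z}$ has a natural density $d(A)=\lim_{n\to\infty}|A\cap[1,n]|/n$. The upper Buck density of $X\subset\mathbb{N}$ is $\overline{\mu}(X)=\inf\{d(A): X\subset A\in\mathcal{Z}\}$. For $m\ge1$, $\varphi_m:\mathbb{Z}\to\mathbb{Z}/m\mathbb{Z}$ is the canonical projection and $\overline{X}^{(m)}=\varphi_m(X)$. A subset $S$ of $\mathbb{Z}/q\mathbb{Z}$ is periodic if there is $g\ne0$ with $S+g\subset S$ (equivalently $S+H=S$ for a non-trivial subgroup $H$). A non-periodic subset $S$ of an abelian group is quasi-periodic if there exist a non-trivial subgroup $K$, an element $s\in S$ and a non-empty set $S''\subsetneq K$ such that $S':=S\setminus(s+S'')$ satisfies $S'+K=S'$. An arithmetic progression in $\mathbb{Z}/q\mathbb{Z}$ is a set $\{a+jd:0\le j<n\}$. *)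

theory Defs
  imports Complex_Main "HOL-Algebra.Elementary_Groups" "HOL-Library.Set_Algebras"
begin

section \<open>Upper Buck density\<close>

definition progression :: "nat \<Rightarrow> nat \<Rightarrow> nat set" where
  "progression a k = range (\<lambda>n. a + k * n)"

text \<open>Common differences may be 0, so finite sets belong to the family.\<close>

definition buck_family :: "nat set set" where
  "buck_family = {A. \<exists>(r::nat) a k. A = (\<Union>i\<in>{1..r}. progression (a i) (k i))}"

text \<open>The density is only used on \<^const>\<open>buck_family\<close>, where the limit exists.\<close>

definition natural_density :: "nat set \<Rightarrow> real" where
  "natural_density A = lim (\<lambda>n. real (card (A \<inter> {1..n})) / real n)"

definition upper_buck_density :: "nat set \<Rightarrow> real" where
  "upper_buck_density X = Inf (natural_density ` {A \<in> buck_family. X \<subseteq> A})"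

text \<open>
  \<open>minimal_modulus q A\<close>: \<open>q\<close> is the least positive integer such that \<open>A\<close> is a finite union of
  progressions all of difference \<open>q\<close>.
\<close>

definition union_of_progressions :: "nat \<Rightarrow> nat set \<Rightarrow> bool" where
  "union_of_progressions q A \<longleftrightarrow> (\<exists>(r::nat) a. A = (\<Union>j\<in>{1..r}. progression (a j) q))"

definition minimal_modulus :: "nat \<Rightarrow> nat set \<Rightarrow> bool" where
  "minimal_modulus q A \<longleftrightarrow>
     q > 0 \<and> union_of_progressions q A \<and>
     (\<forall>p. p > 0 \<and> union_of_progressions p A \<longrightarrow> q \<le> p)"

section \<open>Subsets of abelian groups\<close>

text \<open>
  Groups are written multiplicatively. The group of integers modulo \<open>m\<close> is
  \<^term>\<open>integer_mod_group m\<close>, with carrier \<^term>\<open>{0..<int m}\<close> for positive \<open>m\<close>.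
\<close>

definition proj_mod :: "nat \<Rightarrow> int \<Rightarrow> int" where
  "proj_mod m x = x mod int m"

definition residues_mod :: "nat \<Rightarrow> nat set \<Rightarrow> int set" where
  "residues_mod m X = proj_mod m ` int ` X"

definition periodic_set :: "('a, 'b) monoid_scheme \<Rightarrow> 'a set \<Rightarrow> bool" where
  "periodic_set G S \<longleftrightarrow> (\<exists>g\<in>carrier G. g \<noteq> \<one>\<^bsub>G\<^esub> \<and> S #>\<^bsub>G\<^esub> g \<subseteq> S)"

text \<open>
  The periodic part \<open>S'\<close> is required to be non-empty, as in Kemperman's notion. Otherwise the
  choice of \<open>K\<close> as the whole group and empty \<open>S'\<close> would make every non-empty non-periodic subset
  of a non-trivial group quasi-periodic.
\<close>

definition quasi_periodic_set :: "('a, 'b) monoid_scheme \<Rightarrow> 'a set \<Rightarrow> bool" where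
  "quasi_periodic_set G S \<longleftrightarrow>
     \<not> periodic_set G S \<and>
     (\<exists>K s S'' S'. subgroup K G \<and> K \<noteq> {\<one>\<^bsub>G\<^esub>} \<and> s \<in> S \<and> S'' \<noteq> {} \<and> S'' \<subset> K \<and>
        S' = S - (s <#\<^bsub>G\<^esub> S'') \<and> S' \<noteq> {} \<and> S' <#>\<^bsub>G\<^esub> K = S')"

definition arith_progression :: "('a, 'b) monoid_scheme \<Rightarrow> 'a set \<Rightarrow> bool" where
  "arith_progression G S \<longleftrightarrow>
     (\<exists>a\<in>carrier G. \<exists>d\<in>carrier G. \<exists>n::nat. S = {a \<otimes>\<^bsub>G\<^esub> (d [^]\<^bsub>G\<^esub> j) | j::nat. j < n})"

end

theory Submission
  imports Defs
begin

text \<open>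
  A finite exceptional set costs nothing in density, so $\overline\mu(X)$ is the infimum over $m$ of
  $|X \bmod m|/m$. If $m$ satisfies $|(X+X) \bmod m|/m < 2\overline\mu(X)$ and $q$ generates the
  periods of $X + X$ modulo $m$, then $(X+X) \bmod q$ is aperiodic and
  Kneser's theorem gives it exactly $2r-1$ elements, $r = |X \bmod q|$. A modulus with a smaller
  quotient would lead to a multiple $kq$ of $q$ with $R$ residues of $X$ and
  $2R-1 < k(2r-1) < 2R$, which is impossible; hence $\overline\mu(X+X) = (2r-1)/q$.

  The structure of $A + A$ comes from Hamidoune's isoperimetric method: translates of a set $U$ minimizing
  $|A+U| - |U|$ intersect either trivially or completely. Among non-empty $U$ the minimum is attained by a
  subgroup, which yields Kneser's theorem by induction. Among $|U| \ge 2$ it leads to a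
  subgroup or a two-element set $V$ with $|A+V| < |A|+|V|$. In the first case only one coset of the subgroup can
  be partially covered by $A + A$; in the second $A$ is an arithmetic progression, up to a periodic part. If $A + A$ misses just one element of
  the group, the group has even order and a subgroup of order two makes $A + A$ quasi-periodic.
\<close>

text \<open>The induction behind Kneser's theorem needs a smaller set whose sumset is again
  aperiodic. A subgroup \<open>H\<close> of minimal excess provides it: if |B + B| < 2|B| - 1, then
  \<open>B\<close> has so few holes in its cosets of \<open>H\<close> that \<open>B + B\<close> is
  defective in a single coset 2c + H, and this coset arises only as c + H plus itself. Any period of
  the sumset of the slice in c + H would therefore extend to \<open>B + B\<close>.

  For the structure theorem the obstacle is a 2-atom that is neither a subgroup nor a pair. Its
  translates meet in at most one point, so sums with it grow too fast for it to have a small partner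
  of either kind. It is also smaller than \<open>B\<close>, so exchanging the two roles would
  produce such a partner by induction. The contradiction forces the slices of \<open>B\<close> to be
  single points or nearly full, and the subgroup generated by the atom serves \<open>B\<close>
  instead.

  The value 2r - 1 is squeezed from two sides: r/q bounds the density of X from above, so the
  hypothesis leaves fewer than 2r residues of X + X, and Kneser's theorem gives at least 2r -
  1.\<close>

section \<open>Finite subgroups and translates of sets\<close>

definition finite_subgroup :: "'a::ab_group_add set \<Rightarrow> bool" where
  "finite_subgroup H \<longleftrightarrow> finite H \<and> 0 \<in> H \<and> (\<forall>x\<in>H. \<forall>y\<in>H. x + y \<in> H)"

definition periodic :: "'a::ab_group_add set \<Rightarrow> bool" where
  "periodic S \<longleftrightarrow> (\<exists>g. g \<noteq> 0 \<and> (+) g ` S \<subseteq> S)"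

lemma card_translate [simp]: "card ((+) g ` S) = card (S :: 'a::ab_group_add set)"
  by (simp add: card_image)

lemma translate_subset_eq:
  fixes S :: "'a::ab_group_add set"
  assumes "finite S" "(+) g ` S \<subseteq> S"
  shows "(+) g ` S = S"
  using assms by (intro card_subset_eq) auto

lemma translate_eq_elt_set_plus: "(+) g ` B = g +o B"
  by (auto simp: elt_set_plus_def)

lemma set_plus_translate: "A + (+) g ` B = (+) g ` (A + B)" for A :: "'a::ab_group_add set"
  by (simp add: translate_eq_elt_set_plus set_plus_rearrange4)

lemma set_plus_translate_left: "(+) g ` A + B = (+) g ` (A + B)" for A :: "'a::ab_group_add set"
  by (simp add: translate_eq_elt_set_plus set_plus_rearrange3)

lemma uminus_image_set_plus: "uminus ` (A + B) = uminus ` A + uminus ` B" for A :: "'a::ab_group_add set"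
proof (intro equalityI subsetI)
  fix x assume "x \<in> uminus ` (A + B)"
  then obtain a b where "a \<in> A" "b \<in> B" "x = - a + - b" by (auto elim!: set_plus_elim)
  then show "x \<in> uminus ` A + uminus ` B" by blast
next
  fix x assume "x \<in> uminus ` A + uminus ` B"
  then obtain a b where "a \<in> A" "b \<in> B" "x = - (a + b)" by (auto elim!: set_plus_elim)
  then show "x \<in> uminus ` (A + B)" by blast
qed

lemma card_uminus_image [simp]: "card (uminus ` A) = card (A :: 'a::ab_group_add set)"
  by (simp add: card_image)

lemma card_le_card_set_plus:
  fixes A B :: "'a::ab_group_add set"
  assumes "finite A" "finite B" "A \<noteq> {}"
  shows "card B \<le> card (A + B)"
proof -
  obtain a where "a \<in> A" using assms by blast
  then have "(+) a ` B \<subseteq> A + B" by (auto simp: set_plus_def)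
  then have "card ((+) a ` B) \<le> card (A + B)"
    using assms by (intro card_mono finite_set_plus)
  then show ?thesis by simp
qed

text \<open>Finiteness supplies inverses: translation by \<open>x\<close> maps \<open>H\<close>
  injectively into itself, hence onto, and 0 is hit.\<close>

lemma finite_subgroup_uminus:
  assumes "finite_subgroup H" "x \<in> H"
  shows "- x \<in> H"
proof -
  have fin: "finite H" and "(+) x ` H \<subseteq> H"
    using assms by (auto simp: finite_subgroup_def)
  then have "(+) x ` H = H" by (rule translate_subset_eq)
  moreover have "0 \<in> H" using assms by (simp add: finite_subgroup_def)
  ultimately obtain y where "y \<in> H" "0 = x + y" by (metis imageE)
  then show ?thesis by (metis neg_eq_iff_add_eq_0)
qed

lemma finite_subgroupD:
  assumes "finite_subgroup H"
  shows "finite H" "0 \<in> H" "\<And>x y. x \<in> H \<Longrightarrow> y \<in> H \<Longrightarrow> x + y \<in> H"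
    "\<And>x. x \<in> H \<Longrightarrow> - x \<in> H" "\<And>x y. x \<in> H \<Longrightarrow> y \<in> H \<Longrightarrow> x - y \<in> H"
proof -
  show *: "finite H" "0 \<in> H" "\<And>x y. x \<in> H \<Longrightarrow> y \<in> H \<Longrightarrow> x + y \<in> H"
    "\<And>x. x \<in> H \<Longrightarrow> - x \<in> H"
    using assms finite_subgroup_uminus by (auto simp: finite_subgroup_def)
  show "\<And>x y. x \<in> H \<Longrightarrow> y \<in> H \<Longrightarrow> x - y \<in> H"
    by (metis *(3,4) uminus_add_conv_diff add.commute)
qed

lemma subgroup_set_plus_subset:
  assumes "finite_subgroup K" "A \<subseteq> K" "B \<subseteq> K"
  shows "A + B \<subseteq> K"
  using assms by (auto simp: set_plus_def finite_subgroup_def)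

lemma subset_set_plus_subgroup: "finite_subgroup H \<Longrightarrow> A \<subseteq> A + H"
  by (force simp: set_plus_def finite_subgroup_def)

lemma subgroup_set_plus_self: "finite_subgroup H \<Longrightarrow> H + H = H"
  by (meson dual_order.refl subset_antisym subset_set_plus_subgroup subgroup_set_plus_subset)

lemma periodic_subgroup:
  assumes "finite_subgroup K" "K \<noteq> {0}"
  shows "periodic K"
proof -
  obtain g where "g \<in> K" "g \<noteq> 0" using assms by (auto simp: finite_subgroup_def)
  then show ?thesis using assms by (auto simp: periodic_def finite_subgroup_def)
qed

section \<open>Fragments and atoms\<close>

text \<open>These are the admissible sets for Hamidoune's k-th isoperimetric number, which is the
  minimum of \<open>excess\<close> over them; usually only the minimizers are called fragments. The
  two bounds by \<open>k\<close> trade places when \<open>U\<close> is replaced by the complement of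
  \<open>A + U\<close>.\<close>

definition fragment :: "nat \<Rightarrow> 'a::ab_group_add set \<Rightarrow> 'a set \<Rightarrow> 'a set \<Rightarrow> bool" where
  "fragment k K A U \<longleftrightarrow> U \<subseteq> K \<and> k \<le> card U \<and> card (A + U) + k \<le> card K"

definition excess :: "'a::ab_group_add set \<Rightarrow> 'a set \<Rightarrow> int" where
  "excess A U = int (card (A + U)) - int (card U)"

text \<open>The complement of \<open>A + U\<close> is a fragment for \<open>- A\<close>. Minimizing over both signs therefore gives
  \<open>card U \<le> card (K - (A + U))\<close> for an atom \<open>U\<close>, which the intersection property below needs.\<close>

definition atom :: "nat \<Rightarrow> 'a::ab_group_add set \<Rightarrow> 'a set \<Rightarrow> 'a set \<Rightarrow> bool" where
  "atom k K A U \<longleftrightarrow> fragment k K A U \<and>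
     (\<forall>B\<in>{A, uminus ` A}. \<forall>V. fragment k K B V \<longrightarrow>
        excess A U \<le> excess B V \<and> (excess B V = excess A U \<longrightarrow> card U \<le> card V))"

text \<open>Pairs of a sign and a fragment are minimized lexicographically, first by excess and then
  by size. Truncation by \<open>nat\<close> loses nothing, since \<open>A + U\<close> contains a
  translate of \<open>U\<close>.\<close>

lemma ex_atom:
  assumes "finite_subgroup K" "A \<subseteq> K" "A \<noteq> {}" "fragment k K A U"
  obtains B V where "B = A \<or> B = uminus ` A" "atom k K B V"
proof -
  define P where "P = (\<lambda>p. (fst p = A \<or> fst p = uminus ` A) \<and> fragment k K (fst p) (snd p))"
  define f where "f = (\<lambda>p::'a set \<times> 'a set. nat (excess (fst p) (snd p)))"
  have nonneg: "excess (fst p) (snd p) \<ge> 0" if "P p" for p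
  proof -
    have "finite K" using assms by (auto simp: finite_subgroup_def)
    then have "finite A" "finite (snd p)" using that assms
      by (auto simp: P_def fragment_def dest: finite_subset)
    then show ?thesis
      using that assms(3) card_le_card_set_plus[of "fst p" "snd p"] unfolding P_def excess_def
      by (metis diff_ge_0_iff_ge finite_imageI image_is_empty of_nat_mono)
  qed
  have "P (A, U)" using assms by (simp add: P_def)
  then obtain p where p: "P p" "\<And>q. P q \<Longrightarrow> f p \<le> f q"
    using ex_has_least_nat[of P] by metis
  then obtain q where q: "P q \<and> f q = f p"
    "\<And>r. P r \<and> f r = f p \<Longrightarrow> card (snd q) \<le> card (snd r)"
    using ex_has_least_nat[of "\<lambda>r. P r \<and> f r = f p" p "\<lambda>r. card (snd r)"] by blast
  obtain B V where BV: "q = (B, V)" by force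
  have B: "B = A \<or> B = uminus ` A" using q BV by (auto simp: P_def)
  have "atom k K B V" unfolding atom_def
  proof (intro conjI ballI allI impI)
    show "fragment k K B V" using q BV by (auto simp: P_def)
    fix C W assume C: "C \<in> {B, uminus ` B}" and W: "fragment k K C W"
    have PC: "P (C, W)" using C W B by (auto simp: P_def image_image)
    have "f (B, V) \<le> f (C, W)" using p(2)[OF PC] q(1) BV by simp
    then have "nat (excess B V) \<le> nat (excess C W)" by (simp add: f_def)
    then show le: "excess B V \<le> excess C W"
      using nonneg[OF PC] by (auto simp: nat_le_iff)
    show "card V \<le> card W" if "excess C W = excess B V"
      using q(2)[of "(C,W)"] PC that q(1) BV by (simp add: f_def)
  qed
  with B that show thesis by blast
qed

text \<open>If \<open>- a + w\<close> were an element x of \<open>U\<close>, then w = a + x would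
  lie in \<open>A + U\<close>; hence \<open>- A\<close> plus the complement of \<open>A + U\<close>
  avoids \<open>U\<close>.\<close>

lemma dual_fragment:
  assumes K: "finite_subgroup K" and A: "A \<subseteq> K" and U: "fragment k K A U"
  shows "fragment k K (uminus ` A) (K - (A + U))"
    and "excess (uminus ` A) (K - (A + U)) \<le> excess A U"
proof -
  let ?W = "K - (A + U)"
  have fin: "finite K" using K by (simp add: finite_subgroup_def)
  have UK: "U \<subseteq> K" using U by (simp add: fragment_def)
  have sub: "uminus ` A + ?W \<subseteq> K - U"
  proof
    fix x assume "x \<in> uminus ` A + ?W"
    then obtain a w where aw: "a \<in> A" "w \<in> ?W" "x = - a + w" by (auto elim!: set_plus_elim)
    then have "a \<in> K" "w \<in> K" using A by auto
    then have "x \<in> K" using aw(3) finite_subgroupD(5)[OF K] by simp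
    moreover have "x \<notin> U"
      using aw set_plus_intro[of a A x U] by (auto simp: algebra_simps)
    ultimately show "x \<in> K - U" by simp
  qed
  have AU: "A + U \<subseteq> K" by (rule subgroup_set_plus_subset[OF K A UK])
  have 1: "card ?W = card K - card (A + U)"
    using AU fin by (simp add: card_Diff_subset finite_subset)
  have "card (uminus ` A + ?W) \<le> card (K - U)"
    using sub fin by (intro card_mono) auto
  also have "\<dots> = card K - card U"
    using UK fin by (simp add: card_Diff_subset finite_subset)
  finally have 2: "card (uminus ` A + ?W) \<le> card K - card U" .
  have 3: "card (A + U) \<le> card K" "card U \<le> card K" using AU UK fin by (auto intro: card_mono)
  show "fragment k K (uminus ` A) ?W"
    using 1 2 3 U by (auto simp: fragment_def)
  show "excess (uminus ` A) ?W \<le> excess A U"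
    using 1 2 3 by (auto simp: excess_def)
qed

lemma excess_translate [simp]: "excess A ((+) g ` U) = excess A U"
  by (simp add: excess_def set_plus_translate)

lemma atom_translate:
  assumes "finite_subgroup K" "g \<in> K" "atom k K A U"
  shows "atom k K A ((+) g ` U)"
  using assms
  by (auto simp: atom_def fragment_def set_plus_translate finite_subgroup_def)

text \<open>Cardinality is modular for U, V and for \<open>A + U\<close>, \<open>A + V\<close>; the
  only loss is that the sum with the intersection may be smaller than the intersection of the two
  sumsets.\<close>

lemma excess_submodular:
  fixes A U V :: "'a::ab_group_add set"
  assumes "finite A" "finite U" "finite V"
  shows "excess A (U \<union> V) + excess A (U \<inter> V) \<le> excess A U + excess A V"
proof -
  have "A + (U \<inter> V) \<subseteq> (A + U) \<inter> (A + V)" by (auto simp: set_plus_def)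
  then have "card (A + (U \<inter> V)) \<le> card ((A + U) \<inter> (A + V))"
    using assms by (intro card_mono) (auto intro: finite_set_plus)
  moreover have "card (A + (U \<union> V)) + card ((A + U) \<inter> (A + V)) = card (A + U) + card (A + V)"
    using assms by (simp add: set_plus_Un card_Un_Int[symmetric] finite_set_plus)
  moreover have "card (U \<union> V) + card (U \<inter> V) = card U + card V"
    using assms by (simp add: card_Un_Int[symmetric])
  ultimately show ?thesis by (simp add: excess_def)
qed

text \<open>By submodularity, a union of excess at least that of \<open>U\<close> leaves an
  intersection of excess at most that of \<open>U\<close>. The intersection is then itself a
  fragment of minimal excess, and minimal size makes it all of \<open>U\<close>.\<close>

lemma atom_Int_translate:
  assumes K: "finite_subgroup K" and A: "A \<subseteq> K" and U: "atom k K A U" and g: "g \<in> K"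
    and k: "k \<le> card (U \<inter> (+) g ` U)"
  shows "(+) g ` U = U"
proof -
  let ?V = "(+) g ` U"
  have fin: "finite K" using K by (simp add: finite_subgroup_def)
  have frag: "fragment k K A U" using U by (simp add: atom_def)
  then have UK: "U \<subseteq> K" by (simp add: fragment_def)
  have VK: "?V \<subseteq> K" using UK g K by (auto simp: finite_subgroup_def)
  have finA: "finite A" and finU: "finite U" using A UK fin by (auto intro: finite_subset)
  have AU: "A + U \<subseteq> K" by (rule subgroup_set_plus_subset[OF K A UK])
  have "card U \<le> card (K - (A + U))"
  proof -
    note d = dual_fragment[OF K A frag]
    have "excess A U \<le> excess (uminus ` A) (K - (A + U))"
      using U d(1) by (auto simp: atom_def)
    then show ?thesis using U d by (auto simp: atom_def)
  qed
  then have small: "card U + card (A + U) \<le> card K"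
    using AU fin card_mono[OF fin AU] by (simp add: card_Diff_subset finite_subset)
  have sub: "excess A (U \<union> ?V) + excess A (U \<inter> ?V) \<le> 2 * excess A U"
    using excess_submodular[of A U ?V] finA finU by simp
  have cU: "card (U \<union> ?V) + card (U \<inter> ?V) = 2 * card U"
    using finU by (simp add: card_Un_Int[symmetric])
  \<comment> \<open>When the union is too large to be a fragment, the bound is numerical: its sumset
    has more than |K| - k elements, the union itself at most 2|U| - k, and \<open>small\<close>
    leaves more than |A + U| - |U|.\<close>
  have "excess A U \<le> excess A (U \<union> ?V)"
  proof (cases "card (A + (U \<union> ?V)) + k \<le> card K")
    case True
    have "card U \<le> card (U \<union> ?V)" using finU by (intro card_mono) auto
    then have "fragment k K A (U \<union> ?V)" using True UK VK frag by (auto simp: fragment_def)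
    then show ?thesis using U by (auto simp: atom_def)
  next
    case False
    then show ?thesis using cU small k by (simp add: excess_def)
  qed
  then have le: "excess A (U \<inter> ?V) \<le> excess A U" using sub by simp
  have "card (A + (U \<inter> ?V)) \<le> card (A + U)"
    using finA finU by (intro card_mono set_plus_mono2) (auto intro: finite_set_plus)
  then have "fragment k K A (U \<inter> ?V)"
    using k frag UK by (auto simp: fragment_def)
  then have "card U \<le> card (U \<inter> ?V)" using U le by (auto simp: atom_def)
  then have "U \<inter> ?V = U" using finU by (intro card_seteq) auto
  then show ?thesis using finU by (metis card_translate card_subset_eq finite_imageI inf.absorb_iff1)
qed

text \<open>The overlap of size \<open>k\<close> forces every translate \<open>u + U\<close> with u
  in \<open>U\<close> to equal \<open>U\<close>, which is closure under addition.\<close>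

lemma atom_subgroup:
  assumes "finite_subgroup K" "A \<subseteq> K" "atom k K A U" "0 \<in> U"
    and k: "\<And>u. u \<in> U \<Longrightarrow> k \<le> card (U \<inter> (+) u ` U)"
  shows "finite_subgroup U"
proof -
  have UK: "U \<subseteq> K" using assms by (simp add: atom_def fragment_def)
  moreover have "(+) u ` U = U" if "u \<in> U" for u
    using atom_Int_translate[OF assms(1-3) _ k] that UK by blast
  then have "u + v \<in> U" if "u \<in> U" "v \<in> U" for u v
    using that by blast
  ultimately show ?thesis
    using assms by (auto simp: finite_subgroup_def intro: finite_subset)
qed

lemma uminus_image_subgroup:
  assumes "finite_subgroup H" shows "uminus ` H = H"
  using finite_subgroupD(4)[OF assms] by (force simp: image_iff)

lemma card_uminus_set_plus_subgroup:
  assumes "finite_subgroup H" shows "card (uminus ` A + H) = card (A + H)"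
  by (metis assms card_uminus_image uminus_image_set_plus uminus_image_subgroup)

lemma fragment_1_iff:
  assumes "finite_subgroup K" "A \<subseteq> K" "U \<subseteq> K"
  shows "fragment 1 K A U \<longleftrightarrow> U \<noteq> {} \<and> A + U \<noteq> K"
proof -
  have fin: "finite K" using assms by (simp add: finite_subgroup_def)
  have AU: "A + U \<subseteq> K" by (rule subgroup_set_plus_subset[OF assms])
  have "card (A + U) < card K \<longleftrightarrow> A + U \<noteq> K"
    using AU fin psubset_card_mono[of K "A + U"] by auto
  moreover have "1 \<le> card U \<longleftrightarrow> U \<noteq> {}"
    using assms(3) fin by (metis One_nat_def Suc_leI card_gt_0_iff finite_subset not_one_le_zero card.empty)
  ultimately show ?thesis using assms by (auto simp: fragment_def)
qed

text \<open>For k = 1 an atom containing 0 is a subgroup, because u belongs to both \<open>H\<close>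
  and \<open>u + H\<close>. The atom may have been found for \<open>- A\<close>, but H = - H gives
  |- A + H| = |A + H|, so the sign is immaterial.\<close>

lemma ex_subgroup_minimizing_excess:
  assumes K: "finite_subgroup K" and A: "A \<subseteq> K" "A \<noteq> {}" and U: "U \<subseteq> K" "U \<noteq> {}" "A + U \<noteq> K"
  obtains H where "finite_subgroup H" "H \<subseteq> K" "A + H \<noteq> K"
    "\<And>V. V \<subseteq> K \<Longrightarrow> V \<noteq> {} \<Longrightarrow> A + V \<noteq> K \<Longrightarrow> excess A H \<le> excess A V"
proof -
  have "fragment 1 K A U" using fragment_1_iff[OF K A(1) U(1)] U by simp
  then obtain B V where B: "B = A \<or> B = uminus ` A" and V: "atom 1 K B V"
    using ex_atom[OF K A] by blast
  have BK: "B \<subseteq> K" using B A finite_subgroupD(4)[OF K] by auto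
  have VK: "V \<subseteq> K" and "card V \<ge> 1" using V by (auto simp: atom_def fragment_def)
  then obtain v where v: "v \<in> V" by fastforce
  define H where "H = (+) (- v) ` V"
  have atom: "atom 1 K B H"
    unfolding H_def using v VK finite_subgroupD(4)[OF K] by (intro atom_translate[OF K _ V]) auto
  have H0: "0 \<in> H" using v by (force simp: H_def image_iff)
  have HK: "H \<subseteq> K" using atom by (auto simp: atom_def fragment_def)
  have finH: "finite H" using HK K by (auto simp: finite_subgroup_def intro: finite_subset)
  have H: "finite_subgroup H"
  proof (rule atom_subgroup[OF K BK atom H0])
    fix u assume "u \<in> H"
    then have "u \<in> H \<inter> (+) u ` H" using H0 by (force simp: image_iff)
    then show "1 \<le> card (H \<inter> (+) u ` H)"
      using finH by (metis One_nat_def Suc_leI card_gt_0_iff empty_iff finite_Int)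
  qed
  have card_eq: "card (B + H) = card (A + H)"
    using B card_uminus_set_plus_subgroup[OF H] by auto
  then have ex: "excess B H = excess A H" by (simp add: excess_def)
  have "fragment 1 K A H" using atom card_eq by (simp add: atom_def fragment_def)
  then have "A + H \<noteq> K" using fragment_1_iff[OF K A(1) HK] by simp
  moreover have "excess A H \<le> excess A W" if "W \<subseteq> K" "W \<noteq> {}" "A + W \<noteq> K" for W
  proof -
    have "fragment 1 K A W" using fragment_1_iff[OF K A(1) that(1)] that by simp
    moreover have "A \<in> {B, uminus ` B}" using B by (auto simp: image_image)
    ultimately show ?thesis using atom ex by (auto simp: atom_def)
  qed
  ultimately show thesis using that H HK by blast
qed

section \<open>Generated subgroups and cosets\<close>

text \<open>The ambient group is cut down to this \<open>K\<close> so that a proper subgroup of it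
  never contains \<open>A\<close>; when 0 lies in \<open>A\<close>, a proper subgroup then splits
  \<open>A\<close> into at least two cosets.\<close>

definition generates :: "'a::ab_group_add set \<Rightarrow> 'a set \<Rightarrow> bool" where
  "generates A K \<longleftrightarrow> finite_subgroup K \<and> A \<subseteq> K \<and> (\<forall>H. finite_subgroup H \<and> A \<subseteq> H \<longrightarrow> K \<subseteq> H)"

lemma ex_generates:
  assumes "finite_subgroup G" "A \<subseteq> G"
  obtains K where "generates A K" "K \<subseteq> G"
proof -
  let ?F = "{H. finite_subgroup H \<and> A \<subseteq> H}"
  have "G \<in> ?F" using assms by simp
  then have "finite_subgroup (\<Inter>?F)"
    unfolding finite_subgroup_def[of "\<Inter>?F"]
    by (auto simp: finite_subgroup_def intro: finite_subset[OF Inter_lower])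
  then have "generates A (\<Inter>?F)" unfolding generates_def by blast
  moreover have "\<Inter>?F \<subseteq> G" using \<open>G \<in> ?F\<close> by blast
  ultimately show thesis using that by blast
qed

lemma periodic_translate: "periodic ((+) g ` S) \<longleftrightarrow> periodic S"
proof -
  have "(+) h ` (+) g ` S \<subseteq> (+) g ` S \<longleftrightarrow> (+) h ` S \<subseteq> S" for h
  proof -
    have "(+) h ` (+) g ` S = (+) g ` (+) h ` S"
      by (auto simp: image_image add.left_commute)
    then show ?thesis by (simp add: inj_image_subset_iff)
  qed
  then show ?thesis by (simp add: periodic_def)
qed

lemma mem_coset: "x \<in> (+) a ` H \<longleftrightarrow> x - a \<in> H" for a :: "'a::ab_group_add"
  by (force simp: image_iff)

lemma coset_eq:
  assumes "finite_subgroup H" "x - y \<in> H" shows "(+) x ` H = (+) y ` H"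
proof -
  have "z - x \<in> H \<longleftrightarrow> z - y \<in> H" for z
    using finite_subgroupD(3,5)[OF assms(1)] assms(2)
    by (metis add_diff_cancel diff_add_cancel add_diff_eq diff_diff_eq2)
  then show ?thesis by (auto simp: mem_coset set_eq_iff simp del: image_iff)
qed

section \<open>Sumsets of nearly periodic sets\<close>

text \<open>Pigeonhole: \<open>X\<close> and \<open>z - Y\<close> both lie in the coset
  \<open>a + H\<close> and are too large to be disjoint.\<close>

lemma sumset_contains_coset:
  assumes H: "finite_subgroup H" and XY: "X \<subseteq> (+) a ` H" "Y \<subseteq> (+) b ` H"
    and card: "card H < card X + card Y" and z: "z - (a + b) \<in> H"
  shows "z \<in> X + Y"
proof -
  have fin: "finite ((+) a ` H)" using H by (simp add: finite_subgroup_def)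
  let ?Y = "(\<lambda>y. z - y) ` Y"
  have Y: "?Y \<subseteq> (+) a ` H"
  proof
    fix x assume "x \<in> ?Y"
    then obtain y where y: "y \<in> Y" "x = z - y" by blast
    then have "y - b \<in> H" using XY(2) by (auto simp: mem_coset)
    then have "(z - (a + b)) - (y - b) \<in> H" using z finite_subgroupD(5)[OF H] by blast
    then show "x \<in> (+) a ` H" unfolding mem_coset y(2) by (simp add: algebra_simps)
  qed
  have "card ?Y = card Y" by (intro card_image inj_onI) simp
  have "X \<inter> ?Y \<noteq> {}"
  proof
    assume "X \<inter> ?Y = {}"
    then have "card (X \<union> ?Y) = card X + card Y"
      using \<open>card ?Y = card Y\<close> XY(1) Y fin
      by (metis card_Un_disjoint finite_subset)
    moreover have "card (X \<union> ?Y) \<le> card ((+) a ` H)"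
      using XY Y fin by (intro card_mono) auto
    ultimately show False using card by simp
  qed
  then obtain x y where "x \<in> X" "y \<in> Y" "x = z - y" by blast
  then show ?thesis by (metis diff_add_cancel set_plus_intro)
qed

text \<open>\<open>A\<close> leaves fewer than |H| places of \<open>A + H\<close> empty, so two
  different cosets, with 2|H| places together, contain more than |H| elements of
  \<open>A\<close>.\<close>

lemma card_two_coset_parts:
  assumes H: "finite_subgroup H" and A: "finite A" "card (A + H) < card A + card H"
    and ab: "a \<in> A" "b \<in> A" "a - b \<notin> H"
  shows "card H < card (A \<inter> (+) a ` H) + card (A \<inter> (+) b ` H)"
proof -
  let ?C = "\<lambda>x. (+) x ` H"
  have finH: "finite H" using H by (simp add: finite_subgroup_def)
  have sub: "?C a \<subseteq> A + H" "?C b \<subseteq> A + H" using ab by auto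
  have disj: "?C a \<inter> ?C b = {}"
  proof (rule ccontr)
    assume "?C a \<inter> ?C b \<noteq> {}"
    then obtain x where "x \<in> ?C a" "x \<in> ?C b" by blast
    then have "x - a \<in> H" "x - b \<in> H" by (simp_all only: mem_coset)
    then have "(x - b) - (x - a) \<in> H" using finite_subgroupD(5)[OF H] by blast
    then show False using ab(3) by simp
  qed
  have "card (?C a - A) + card (?C b - A) = card ((?C a - A) \<union> (?C b - A))"
    using disj finH by (intro card_Un_disjoint[symmetric]) auto
  also have "\<dots> \<le> card ((A + H) - A)"
    using sub A finH by (intro card_mono) (auto intro: finite_set_plus)
  also have "\<dots> = card (A + H) - card A"
    using A(1) subset_set_plus_subgroup[OF H] by (intro card_Diff_subset) auto
  finally have 1: "card (?C a - A) + card (?C b - A) \<le> card (A + H) - card A" .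
  have "card (?C x - A) + card (A \<inter> ?C x) = card H" for x
  proof -
    have "card (?C x - A) + card (?C x \<inter> A) = card (?C x)"
      using finH by (metis card_Diff_subset_Int card_Int_Diff add.commute finite_imageI)
    then show ?thesis by (simp add: Int_commute)
  qed
  from this[of a] this[of b] have
    "2 * card H = card (?C a - A) + card (?C b - A) + card (A \<inter> ?C a) + card (A \<inter> ?C b)" by linarith
  moreover have "card (A + H) - card A < card H"
    using A card_mono[OF _ subset_set_plus_subgroup[OF H, of A]] finH by (auto simp: finite_set_plus)
  ultimately show ?thesis using 1 by linarith
qed

text \<open>By pigeonhole, an element of the coset a + b + H can be missing from
  \<open>A + A\<close> only if the slices of \<open>A\<close> in a + H and b + H have at most |H|
  elements together. Then the two cosets coincide and the slice fills at most half of it; there is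
  only one such sparse coset, \<open>c + H\<close>. So all defects lie in 2c + H, and no other pair
  of cosets met by \<open>A\<close> adds up to 2c + H.\<close>

lemma sumset_nearly_periodic:
  assumes H: "finite_subgroup H" and A: "finite A" "card (A + H) < card A + card H"
    and z: "z \<in> A + A + H" "z \<notin> A + A"
  obtains c where "c \<in> A"
    "\<And>w. w \<in> A + A + H \<Longrightarrow> w \<notin> A + A \<Longrightarrow> w - (c + c) \<in> H"
    "\<And>x y. x \<in> A \<Longrightarrow> y \<in> A \<Longrightarrow> x + y - (c + c) \<in> H \<Longrightarrow> x - c \<in> H \<and> y - c \<in> H"
proof -
  let ?C = "\<lambda>x. (+) x ` H"
  have small: "a - b \<in> H \<and> 2 * card (A \<inter> ?C a) \<le> card H"
    if ab: "a \<in> A" "b \<in> A" and w: "w - (a + b) \<in> H" "w \<notin> A + A" for a b w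
  proof -
    have *: "w \<notin> (A \<inter> ?C a) + (A \<inter> ?C b)"
      using w(2) set_plus_mono2[of "A \<inter> ?C a" A "A \<inter> ?C b" A] by blast
    then have le: "card (A \<inter> ?C a) + card (A \<inter> ?C b) \<le> card H"
      using sumset_contains_coset[OF H _ _ _ w(1), of "A \<inter> ?C a" "A \<inter> ?C b"] by force
    then have "a - b \<in> H" using card_two_coset_parts[OF H A ab] by force
    moreover from this have "?C a = ?C b" by (rule coset_eq[OF H])
    ultimately show ?thesis using le by simp
  qed
  have same: "a - c \<in> H" if "a \<in> A" "c \<in> A"
    "2 * card (A \<inter> ?C a) \<le> card H" "2 * card (A \<inter> ?C c) \<le> card H" for a c
    using card_two_coset_parts[OF H A that(1,2)] that(3,4) by force
  have rep: "\<exists>a b. a \<in> A \<and> b \<in> A \<and> w - (a + b) \<in> H" if "w \<in> A + A + H" for w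
  proof -
    obtain a b h where "a \<in> A" "b \<in> A" "h \<in> H" "w = a + b + h"
      using \<open>w \<in> A + A + H\<close> by (metis set_plus_elim)
    then show ?thesis by (intro exI[of _ a] exI[of _ b]) simp
  qed
  obtain c c' where c: "c \<in> A" "c' \<in> A" "z - (c + c') \<in> H" using rep[OF z(1)] by blast
  have c_small: "2 * card (A \<inter> ?C c) \<le> card H" and cc': "c - c' \<in> H"
    using small[OF c z(2)] by auto
  have in_c: "x - c \<in> H \<and> y - c \<in> H"
    if xy: "x \<in> A" "y \<in> A" and w: "w - (x + y) \<in> H" "w \<notin> A + A" for x y w
  proof -
    have "x - c \<in> H" using small[OF xy w] same c(1) c_small xy(1) by blast
    moreover have "w - (y + x) \<in> H" using w by (simp add: add.commute)
    then have "y - c \<in> H" using small[OF xy(2,1) _ w(2)] same c(1) c_small xy(2) by blast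
    ultimately show ?thesis by simp
  qed
  have zc: "z - (c + c) \<in> H"
  proof -
    have "z - (c + c') - (c - c') \<in> H" using c(3) cc' finite_subgroupD(5)[OF H] by blast
    then show ?thesis by (simp add: algebra_simps)
  qed
  show thesis
  proof (rule that[OF c(1)])
    fix w assume w: "w \<in> A + A + H" "w \<notin> A + A"
    then obtain x y where xy: "x \<in> A" "y \<in> A" "w - (x + y) \<in> H" using rep by blast
    then have "x - c \<in> H" "y - c \<in> H" using in_c w(2) by blast+
    then have "w - (x + y) + ((x - c) + (y - c)) \<in> H"
      using xy(3) finite_subgroupD(3)[OF H] by blast
    then show "w - (c + c) \<in> H" by (simp add: algebra_simps)
  next
    fix x y assume xy: "x \<in> A" "y \<in> A" "x + y - (c + c) \<in> H"
    then have "z - (c + c) - (x + y - (c + c)) \<in> H" using zc finite_subgroupD(5)[OF H] by blast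
    then have "z - (x + y) \<in> H" by (simp add: algebra_simps)
    then show "x - c \<in> H \<and> y - c \<in> H" using in_c xy(1,2) z(2) by blast
  qed
qed

lemma ex_missing_element:
  assumes "finite_subgroup H" "H \<noteq> {0}" "\<not> periodic S"
  obtains z where "z \<in> S + H" "z \<notin> S"
proof -
  obtain h where h: "h \<in> H" "h \<noteq> 0" using assms by (auto simp: finite_subgroup_def)
  then have "\<not> (+) h ` S \<subseteq> S" using assms(3) by (auto simp: periodic_def)
  then obtain s where "s \<in> S" "h + s \<notin> S" by blast
  then show thesis using that[of "s + h"] h by (auto simp: add.commute)
qed

section \<open>Kneser's bound for an aperiodic sumset of a set with itself\<close>

text \<open>A counterexample \<open>B\<close> is replaced by its slice \<open>B'\<close> in the only
  coset \<open>c + H\<close> responsible for the defects of \<open>B + B\<close>. The estimates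
  \<open>C1\<close>, \<open>C2\<close>, \<open>C3\<close> and the induction hypothesis combine to
  2|B| <= 2|B + H| - 2|H| + 2|B'| <= |B + B + H| - |H| + |B' + B'| + 1 <= |B + B| + 1.\<close>

lemma kneser_aperiodic_aux:
  fixes B :: "'a::ab_group_add set"
  assumes IH: "\<And>B'. finite_subgroup K \<Longrightarrow> B' \<subseteq> K \<Longrightarrow> card B' < card B \<Longrightarrow> B' \<noteq> {} \<Longrightarrow>
      \<not> periodic (B' + B') \<Longrightarrow> 2 * card B' \<le> card (B' + B') + 1"
    and K: "generates B K" and B: "0 \<in> B" "\<not> periodic (B + B)"
  shows "2 * card B \<le> card (B + B) + 1"
proof (rule ccontr)
  assume "\<not> ?thesis"
  then have contra: "card (B + B) + 1 < 2 * card B" by simp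
  have KG: "finite_subgroup K" and BK: "B \<subseteq> K"
    and min: "\<And>H. finite_subgroup H \<Longrightarrow> B \<subseteq> H \<Longrightarrow> K \<subseteq> H"
    using K by (auto simp: generates_def)
  have finK: "finite K" and finB: "finite B" using KG BK by (auto simp: finite_subgroup_def intro: finite_subset)
  have "K \<noteq> {0}"
  proof
    assume "K = {0}"
    then have "B = {0}" using B BK by auto
    then show False using contra by simp
  qed
  then have "B + B \<noteq> K" using B periodic_subgroup[OF KG] by auto
  then obtain H where H: "finite_subgroup H" "H \<subseteq> K" "B + H \<noteq> K"
    and Hmin: "\<And>V. V \<subseteq> K \<Longrightarrow> V \<noteq> {} \<Longrightarrow> B + V \<noteq> K \<Longrightarrow> excess B H \<le> excess B V"
    using ex_subgroup_minimizing_excess[OF KG BK _ BK] B(1) by blast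
  have finH: "finite H" using H by (simp add: finite_subgroup_def)
  have BBH: "B \<subseteq> B + H" by (rule subset_set_plus_subgroup[OF H(1)])
  have BH_K: "B + H \<subseteq> K" by (rule subgroup_set_plus_subset[OF KG BK H(2)])
  have notBH: "\<not> B \<subseteq> H"
  proof
    assume "B \<subseteq> H"
    then have "K = H" using min H by blast
    then show False using H(3) BH_K set_zero_plus2[OF B(1), of K] by simp
  qed
  \<comment> \<open>\<open>B\<close> competes with \<open>H\<close>: its own excess is below |B| -
    1, so \<open>B\<close> misses fewer than |H| - 1 elements of \<open>B + H\<close>; in particular
    \<open>H\<close> is non-trivial.\<close>
  have "excess B H \<le> excess B B" using Hmin[OF BK _ \<open>B + B \<noteq> K\<close>] B by blast
  then have le: "card (B + H) + 1 < card B + card H"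
    using contra by (simp add: excess_def)
  then have "H \<noteq> {0}" by auto
  then obtain z where z: "z \<in> B + B + H" "z \<notin> B + B" using ex_missing_element H(1) B(2) by blast
  obtain c where c: "c \<in> B"
    and miss: "\<And>w. w \<in> B + B + H \<Longrightarrow> w \<notin> B + B \<Longrightarrow> w - (c + c) \<in> H"
    and rep: "\<And>x y. x \<in> B \<Longrightarrow> y \<in> B \<Longrightarrow> x + y - (c + c) \<in> H \<Longrightarrow> x - c \<in> H \<and> y - c \<in> H"
    using sumset_nearly_periodic[OF H(1) finB _ z] le by (metis add_lessD1)
  define B' where "B' = B \<inter> (+) c ` H"
  have cB': "c \<in> B'" using c H(1) by (simp add: B'_def mem_coset finite_subgroup_def)
  have B'_iff: "x \<in> B' \<longleftrightarrow> x \<in> B \<and> x - c \<in> H" for x by (simp only: B'_def mem_coset Int_iff)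
  have "B' \<noteq> B"
  proof
    assume "B' = B"
    then have *: "\<And>x. x \<in> B \<Longrightarrow> x - c \<in> H" using B'_iff by blast
    have "B \<subseteq> H"
    proof
      fix x assume "x \<in> B"
      then have "(x - c) - (0 - c) \<in> H" using * B(1) finite_subgroupD(5)[OF H(1)] by blast
      then show "x \<in> H" by simp
    qed
    with notBH show False by simp
  qed
  then have "card B' < card B" using finB by (intro psubset_card_mono) (auto simp: B'_def)
  have BB': "B' + B' \<subseteq> (+) (c + c) ` H"
  proof
    fix w assume "w \<in> B' + B'"
    then obtain x y where "w = x + y" "x - c \<in> H" "y - c \<in> H" using B'_iff by (metis set_plus_elim)
    then have "(x - c) + (y - c) \<in> H" using finite_subgroupD(3)[OF H(1)] by blast
    also have "(x - c) + (y - c) = w - (c + c)" using \<open>w = x + y\<close> by (simp add: algebra_simps)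
    finally show "w \<in> (+) (c + c) ` H" unfolding mem_coset .
  qed
  have BB'_iff: "w \<in> B' + B' \<longleftrightarrow> w \<in> B + B \<and> w - (c + c) \<in> H" for w
  proof
    assume "w \<in> B' + B'"
    moreover have "B' + B' \<subseteq> B + B" by (intro set_plus_mono2) (auto simp: B'_def)
    ultimately show "w \<in> B + B \<and> w - (c + c) \<in> H" using BB' mem_coset by blast
  next
    assume "w \<in> B + B \<and> w - (c + c) \<in> H"
    then obtain x y where "x \<in> B" "y \<in> B" "w = x + y" "x + y - (c + c) \<in> H" by (metis set_plus_elim)
    with rep B'_iff show "w \<in> B' + B'" by blast
  qed
  \<comment> \<open>A period of \<open>B' + B'\<close> lies in \<open>H\<close> because
    \<open>B' + B'\<close> lies in one coset. Outside that coset \<open>B + B\<close> is already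
    \<open>H\<close>-periodic, so it would be a period of \<open>B + B\<close>.\<close>
  have "\<not> periodic (B' + B')"
  proof
    assume "periodic (B' + B')"
    then obtain g where g: "g \<noteq> 0" "(+) g ` (B' + B') \<subseteq> B' + B'" by (auto simp: periodic_def)
    then have "g + (c + c) \<in> B' + B'" using cB' by blast
    then have gH: "g \<in> H" using BB'_iff by auto
    have "(+) g ` (B + B) \<subseteq> B + B"
    proof (rule image_subsetI, rule ccontr)
      fix w assume w: "w \<in> B + B" "g + w \<notin> B + B"
      then have "g + w \<in> B + B + H" using gH by (metis add.commute set_plus_intro)
      then have "g + w - (c + c) \<in> H" using miss w(2) by blast
      then have "g + w - (c + c) - g \<in> H" using gH finite_subgroupD(5)[OF H(1)] by blast
      then have "w - (c + c) \<in> H" by (simp add: algebra_simps)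
      then have "w \<in> B' + B'" using BB'_iff w(1) by blast
      then show False using g(2) w(2) BB'_iff by blast
    qed
    then show False using B(2) g(1) by (auto simp: periodic_def)
  qed
  then have IH': "2 * card B' \<le> card (B' + B') + 1"
    using IH[OF KG, of B'] BK cB' \<open>card B' < card B\<close> by (auto simp: B'_def)
  have finBB: "finite (B + B)" using finB by (simp add: finite_set_plus)
  have C1: "card (B + B + H) + card (B' + B') \<le> card (B + B) + card H"
  proof -
    let ?C = "(+) (c + c) ` H"
    have CB: "?C \<subseteq> B + B + H" using c by auto
    have "(B + B + H) - ?C \<subseteq> B + B" using miss unfolding mem_coset[symmetric] by blast
    then have sub: "((B + B + H) - ?C) \<union> (B' + B') \<subseteq> B + B" using BB'_iff by blast
    have "card ((B + B + H) - ?C) + card (B' + B') = card (((B + B + H) - ?C) \<union> (B' + B'))"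
      using BB' finBB finH finB by (intro card_Un_disjoint[symmetric])
        (auto simp: B'_def intro!: finite_set_plus)
    also have "\<dots> \<le> card (B + B)" using sub finBB by (rule card_mono[rotated])
    finally have "card ((B + B + H) - ?C) + card (B' + B') \<le> card (B + B)" .
    moreover have "card ((B + B + H) - ?C) = card (B + B + H) - card H"
      using CB finH by (simp add: card_Diff_subset)
    ultimately show ?thesis by linarith
  qed
  have C2: "card B + card H \<le> card (B + H) + card B'"
  proof -
    let ?C = "(+) c ` H"
    have CB: "?C \<subseteq> B + H" using c by auto
    have finBH: "finite (B + H)" using finB finH by (simp add: finite_set_plus)
    have "B \<subseteq> B' \<union> ((B + H) - ?C)" using BBH by (auto simp: B'_def)
    then have "card B \<le> card (B' \<union> ((B + H) - ?C))"
      using finBH finB by (intro card_mono) (auto simp: B'_def)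
    also have "\<dots> \<le> card B' + card ((B + H) - ?C)" by (rule card_Un_le)
    also have "card ((B + H) - ?C) = card (B + H) - card H"
      using CB finH by (simp add: card_Diff_subset)
    moreover have "card H \<le> card (B + H)" using card_mono[OF finBH CB] by simp
    ultimately show ?thesis by linarith
  qed
  \<comment> \<open>If B + (B + H) is not all of \<open>K\<close>, this is minimality of
    \<open>H\<close> against \<open>B + H\<close>. Otherwise \<open>B + H\<close> and its reflection
    2c - (B + H) meet only in \<open>c + H\<close>, since 2c + H has just one representation, and
    together they fit into \<open>K\<close>.\<close>
  have C3: "2 * card (B + H) \<le> card (B + B + H) + card H"
  proof (cases "B + (B + H) = K")
    case False
    have "excess B H \<le> excess B (B + H)" using Hmin[OF BH_K _ False] B(1) H(1) BBH by blast
    then show ?thesis by (simp add: excess_def add.assoc)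
  next
    case True
    let ?D = "B + H" and ?D' = "(\<lambda>y. c + c - y) ` (B + H)"
    have D'K: "?D' \<subseteq> K" using BH_K c BK finite_subgroupD(3,5)[OF KG] by blast
    have "?D \<inter> ?D' \<subseteq> (+) c ` H"
    proof
      fix x assume "x \<in> ?D \<inter> ?D'"
      then obtain y where "x \<in> B + H" "y \<in> B + H" "x = c + c - y" by blast
      then obtain b h b' h' where x: "x = b + h" "x = c + c - (b' + h')"
        and bh: "b \<in> B" "h \<in> H" "b' \<in> B" "h' \<in> H" by (metis set_plus_elim)
      have "c + c = b + h + (b' + h')" using x by (metis diff_add_cancel)
      then have "b + b' - (c + c) = - (h + h')" by (simp add: algebra_simps)
      moreover have "- (h + h') \<in> H" using bh finite_subgroupD(3,4)[OF H(1)] by blast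
      ultimately have "b - c \<in> H" using rep bh by simp
      then have "b - c + h \<in> H" using bh finite_subgroupD(3)[OF H(1)] by blast
      then show "x \<in> (+) c ` H" unfolding mem_coset x(1) by (simp add: algebra_simps)
    qed
    then have "card (?D \<inter> ?D') \<le> card H" using finH card_mono[of "(+) c ` H" "?D \<inter> ?D'"] by simp
    moreover have "card ?D' = card ?D" by (intro card_image inj_onI) simp
    moreover have "card ?D + card ?D' = card (?D \<union> ?D') + card (?D \<inter> ?D')"
      using BH_K D'K finK by (intro card_Un_Int) (auto intro: finite_subset)
    moreover have "card (?D \<union> ?D') \<le> card K" using BH_K D'K finK by (intro card_mono) auto
    ultimately show ?thesis using True by (simp add: add.assoc)
  qed
  show False using IH' C1 C2 C3 contra by linarith
qed

text \<open>Kneser's theorem for \<open>A + A\<close> with trivial stabilizer. Moving an element of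
  \<open>A\<close> to 0 changes no cardinality, and the generated subgroup becomes the one generated
  by the differences of \<open>A\<close>.\<close>

lemma card_sumset_aperiodic:
  fixes A :: "'a::ab_group_add set"
  assumes "finite_subgroup G" "A \<subseteq> G" "A \<noteq> {}" "\<not> periodic (A + A)"
  shows "2 * card A \<le> card (A + A) + 1"
  using assms
proof (induction "card A" arbitrary: A G rule: less_induct)
  case less
  obtain a where a: "a \<in> A" using less.prems by blast
  define B where "B = (+) (- a) ` A"
  have B0: "0 \<in> B" using a by (force simp: B_def image_iff)
  have BG: "B \<subseteq> G" using a less.prems(2) finite_subgroupD(5)[OF less.prems(1)] by (auto simp: B_def)
  obtain K where K: "generates B K" by (rule ex_generates[OF less.prems(1) BG])
  have BB: "B + B = (+) (- a) ` (+) (- a) ` (A + A)"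
    by (simp only: B_def set_plus_translate set_plus_translate_left)
  then have "\<not> periodic (B + B)" using less.prems by (simp only: periodic_translate not_False_eq_True)
  moreover have cardB: "card B = card A" unfolding B_def by (rule card_translate)
  ultimately have "2 * card B \<le> card (B + B) + 1"
    using less.hyps by (intro kneser_aperiodic_aux[OF _ K B0]) auto
  then show ?case by (simp only: BB cardB card_translate)
qed

section \<open>Small excess\<close>

text \<open>A \<open>2\<close>-atom containing \<open>0\<close> that is not a subgroup has this property.\<close>

definition sidon :: "'a::ab_group_add set \<Rightarrow> bool" where
  "sidon U \<longleftrightarrow> (\<forall>g. g \<noteq> 0 \<longrightarrow> card (U \<inter> (+) g ` U) \<le> 1)"

lemma sidon_card_Un:
  assumes "sidon U" "finite U" "x \<noteq> y"
  shows "2 * card U \<le> card ((+) x ` U \<union> (+) y ` U) + 1" and "card ((+) x ` U \<inter> (+) y ` U) \<le> 1"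
proof -
  have "(+) x ` U \<inter> (+) y ` U = (+) x ` (U \<inter> (+) (y - x) ` U)"
    by (simp add: image_Int image_image add.assoc[symmetric])
  then have "card ((+) x ` U \<inter> (+) y ` U) = card (U \<inter> (+) (y - x) ` U)" by simp
  then show "card ((+) x ` U \<inter> (+) y ` U) \<le> 1" using assms by (simp add: sidon_def)
  moreover have "card ((+) x ` U \<union> (+) y ` U) + card ((+) x ` U \<inter> (+) y ` U) = 2 * card U"
    using assms(2) by (simp add: card_Un_Int[symmetric])
  ultimately show "2 * card U \<le> card ((+) x ` U \<union> (+) y ` U) + 1" by linarith
qed

text \<open>Three translates overlap pairwise in at most one point. This later forces |U| < |B|, the
  decrease that the exchange of roles needs.\<close>

lemma sidon_card_sumset:
  assumes "sidon U" "finite U" "finite B" "3 \<le> card B"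
  shows "3 * card U \<le> card (B + U) + 3"
proof -
  obtain S where "S \<subseteq> B" "card S = 3" using assms(4) by (metis obtain_subset_with_card_n)
  then obtain x y z where xyz: "{x, y, z} \<subseteq> B" "x \<noteq> y" "x \<noteq> z" "y \<noteq> z" by (auto simp: card_3_iff)
  let ?X = "(+) x ` U" and ?Y = "(+) y ` U" and ?Z = "(+) z ` U"
  have "card (?X \<union> ?Y \<union> ?Z) + card ((?X \<union> ?Y) \<inter> ?Z) = card (?X \<union> ?Y) + card ?Z"
    using assms by (intro card_Un_Int[symmetric]) auto
  moreover have "card ((?X \<union> ?Y) \<inter> ?Z) \<le> card (?X \<inter> ?Z) + card (?Y \<inter> ?Z)"
    by (metis Int_Un_distrib2 card_Un_le)
  moreover have "card (?X \<union> ?Y \<union> ?Z) \<le> card (B + U)"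
    using xyz assms by (intro card_mono) (auto intro: finite_set_plus)
  ultimately show ?thesis
    using sidon_card_Un[OF assms(1,2) xyz(2)] sidon_card_Un(2)[OF assms(1,2) xyz(3)]
      sidon_card_Un(2)[OF assms(1,2) xyz(4)] by simp
qed

section \<open>Critical partners and the exchange of roles\<close>

text \<open>The two outcomes from which structure can be read off: a subgroup leaves
  \<open>A\<close> with few holes in its cosets, and a pair {x, y} makes \<open>A\<close> invariant
  under y - x up to one element. A subgroup of order two falls under both.\<close>

definition critical_partner :: "'a::ab_group_add set \<Rightarrow> 'a set \<Rightarrow> 'a set \<Rightarrow> bool" where
  "critical_partner K A V \<longleftrightarrow> V \<subseteq> K \<and> card (A + V) < card A + card V \<and>
     (card V = 2 \<or> finite_subgroup V \<and> V \<noteq> {0} \<and> V \<noteq> K)"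

text \<open>Any two translates of \<open>U\<close> cover at least 2|U| - 1 elements. Against a pair
  this is too many once |U| >= 3.\<close>

lemma sidon_no_critical_partner:
  assumes U: "sidon U" "3 \<le> card U" "0 \<in> U" and K: "generates U K"
  shows "\<not> critical_partner K U V"
proof
  assume V: "critical_partner K U V"
  have finU: "finite U" using U(2) by (metis card.infinite not_numeral_le_zero)
  have finV: "finite V" using V K by (auto simp: critical_partner_def generates_def finite_subgroup_def intro: finite_subset)
  have lower: "2 * card U \<le> card (U + V) + 1" if "x \<in> V" "y \<in> V" "x \<noteq> y" for x y
  proof -
    have "(+) x ` U \<union> (+) y ` U \<subseteq> U + V" using that by (auto simp: add.commute)
    then have "card ((+) x ` U \<union> (+) y ` U) \<le> card (U + V)"
      using finU finV by (intro card_mono finite_set_plus)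
    then show ?thesis using sidon_card_Un(1)[OF U(1) finU that(3)] by linarith
  qed
  have lt: "card (U + V) < card U + card V" using V by (simp add: critical_partner_def)
  show False
  proof (cases "card V = 2")
    case True
    then obtain x y where "V = {x, y}" "x \<noteq> y" by (auto simp: card_2_iff)
    then show False using lower[of x y] lt True U(2) by simp
  next
    case False
    then have H: "finite_subgroup V" "V \<noteq> {0}" "V \<noteq> K" "V \<subseteq> K" using V by (auto simp: critical_partner_def)
    then obtain g where "g \<in> V" "0 \<in> V" "g \<noteq> 0" by (auto simp: finite_subgroup_def)
    then have 1: "2 * card U \<le> card (U + V) + 1" using lower by blast
    \<comment> \<open>\<open>U\<close> meets a second coset of \<open>V\<close>, so |U + V| >= 2|V|.
      Added to |U + V| >= 2|U| - 1 this gives |U + V| >= |U| + |V|, by parity.\<close>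
    have "\<not> U \<subseteq> V" using H K by (auto simp: generates_def)
    then obtain x where x: "x \<in> U" "x \<notin> V" by blast
    have "V \<inter> (+) x ` V = {}"
    proof (rule ccontr)
      assume "V \<inter> (+) x ` V \<noteq> {}"
      then obtain v where "v \<in> V" "v - x \<in> V" by (metis disjoint_iff mem_coset)
      then have "v - (v - x) \<in> V" using finite_subgroupD(5)[OF H(1)] by blast
      then show False using x by simp
    qed
    then have "card (V \<union> (+) x ` V) = 2 * card V" using finV by (simp add: card_Un_disjoint)
    moreover have "V \<union> (+) x ` V \<subseteq> U + V" using x set_zero_plus2[OF U(3)] by blast
    then have "card (V \<union> (+) x ` V) \<le> card (U + V)"
      using finU finV by (intro card_mono finite_set_plus)
    ultimately show False using 1 lt by linarith
  qed
qed

lemma finite_subgroup_stabilizer: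
  assumes "finite_subgroup K" shows "finite_subgroup {k \<in> K. (+) k ` X \<subseteq> X}"
proof -
  have "(+) (k + l) ` X \<subseteq> X" if "(+) k ` X \<subseteq> X" "(+) l ` X \<subseteq> X" for k l
    using that by (simp add: image_subset_iff add.assoc)
  then show ?thesis using assms by (simp add: finite_subgroup_def)
qed

text \<open>\<open>X + U = X\<close> puts \<open>U\<close> into the stabilizer of \<open>X\<close>,
  a subgroup, which therefore contains \<open>K\<close>; so \<open>X\<close> is a union of cosets of
  \<open>K\<close>, and it lies in one.\<close>

lemma full_coset:
  assumes K: "generates U K" and U: "0 \<in> U" and X: "finite X" "X \<noteq> {}" "card (X + U) = card X"
    and c: "X \<subseteq> (+) c ` K"
  shows "X = (+) c ` K"
proof -
  have KG: "finite_subgroup K" and UK: "U \<subseteq> K" using K by (auto simp: generates_def)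
  have "X \<subseteq> X + U" using set_zero_plus2[OF U, of X] by (simp add: add.commute)
  moreover have "finite (X + U)"
    using X KG UK by (auto simp: finite_subgroup_def intro: finite_set_plus finite_subset)
  ultimately have XU: "X + U = X" using X(3) by (metis card_subset_eq)
  let ?H = "{k \<in> K. (+) k ` X \<subseteq> X}"
  have "finite_subgroup ?H" by (rule finite_subgroup_stabilizer[OF KG])
  moreover have "U \<subseteq> ?H"
  proof
    fix u assume "u \<in> U"
    moreover from this have "(+) u ` X \<subseteq> X + U" by (metis add.commute image_subsetI set_plus_intro)
    ultimately show "u \<in> ?H" using UK XU by auto
  qed
  ultimately have stab: "K \<subseteq> ?H" using K by (auto simp: generates_def)
  obtain x where x: "x \<in> X" using X by blast
  have "y \<in> X" if "y - c \<in> K" for y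
  proof -
    have "x - c \<in> K" using x c mem_coset by blast
    then have "(y - c) - (x - c) \<in> K" using that finite_subgroupD(5)[OF KG] by blast
    then have "y - x \<in> K" by simp
    then have "(+) (y - x) ` X \<subseteq> X" using stab by blast
    then have "(y - x) + x \<in> X" using x by blast
    then show ?thesis by simp
  qed
  then have "(+) c ` K \<subseteq> X" by auto
  with c show ?thesis by blast
qed

lemma coset_Int_cases:
  assumes "finite_subgroup K"
  shows "(+) x ` K = (+) y ` K \<or> (+) x ` K \<inter> (+) y ` K = {}"
proof (rule disjCI)
  assume "(+) x ` K \<inter> (+) y ` K \<noteq> {}"
  then obtain z where "z - x \<in> K" "z - y \<in> K" by (metis disjoint_iff mem_coset)
  then have "(z - y) - (z - x) \<in> K" using finite_subgroupD(5)[OF assms] by blast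
  then show "(+) x ` K = (+) y ` K" by (intro coset_eq[OF assms]) simp
qed

lemma card_coset_sum:
  assumes K: "finite_subgroup K" and B: "finite B" and U: "U \<subseteq> K"
  shows "card (B + U) = (\<Sum>C\<in>(\<lambda>x. (+) x ` K) ` B. card (B \<inter> C + U))"
proof -
  let ?\<C> = "(\<lambda>x. (+) x ` K) ` B"
  have finU: "finite U" using K U by (auto simp: finite_subgroup_def intro: finite_subset)
  have sub: "B \<inter> C + U \<subseteq> C" if "C \<in> ?\<C>" for C
  proof
    fix w assume "w \<in> B \<inter> C + U"
    then obtain b u where bu: "b \<in> C" "u \<in> K" "w = b + u" using U by (metis IntD2 set_plus_elim subsetD)
    obtain x where C: "C = (+) x ` K" using \<open>C \<in> ?\<C>\<close> by blast
    then have "b - x \<in> K" using bu(1) mem_coset by blast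
    then have "b - x + u \<in> K" using bu(2) finite_subgroupD(3)[OF K] by blast
    then show "w \<in> C" unfolding C mem_coset bu(3) by (simp add: algebra_simps)
  qed
  have un: "B + U = (\<Union>C\<in>?\<C>. B \<inter> C + U)"
  proof (intro equalityI subsetI)
    fix w assume "w \<in> B + U"
    then obtain b u where bu: "b \<in> B" "u \<in> U" "w = b + u" by (metis set_plus_elim)
    have "b \<in> (+) b ` K" using K by (simp add: mem_coset finite_subgroup_def)
    then have "w \<in> B \<inter> (+) b ` K + U" using bu by blast
    then show "w \<in> (\<Union>C\<in>?\<C>. B \<inter> C + U)" using bu(1) by blast
  next
    fix w assume "w \<in> (\<Union>C\<in>?\<C>. B \<inter> C + U)"
    then show "w \<in> B + U" by (auto elim!: set_plus_elim)
  qed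
  show ?thesis unfolding un
  proof (rule card_UN_disjoint)
    show "finite ?\<C>" using B by simp
    show "\<forall>C\<in>?\<C>. finite (B \<inter> C + U)" using B finU by (auto intro: finite_set_plus)
    show "\<forall>C\<in>?\<C>. \<forall>D\<in>?\<C>. C \<noteq> D \<longrightarrow> (B \<inter> C + U) \<inter> (B \<inter> D + U) = {}"
    proof (intro ballI impI)
      fix C D assume CD: "C \<in> ?\<C>" "D \<in> ?\<C>" "C \<noteq> D"
      then have "C \<inter> D = {}" using coset_Int_cases[OF K] by blast
      then show "(B \<inter> C + U) \<inter> (B \<inter> D + U) = {}" using sub[OF CD(1)] sub[OF CD(2)] by blast
    qed
  qed
qed

text \<open>Splitting \<open>B\<close> along the cosets of \<open>K'\<close> is what allows the two sets of the pair to exchange roles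
  in the induction.\<close>

lemma sidon_atom_cases:
  assumes KG: "finite_subgroup K" and B: "B \<subseteq> K" "2 \<le> card B"
    and U: "fragment 2 K B U" "card (B + U) < card B + card U" "sidon U" "3 \<le> card U" "0 \<in> U"
    and K': "generates U K'"
  shows "critical_partner K B K' \<or>
    (\<exists>W. fragment 2 K' U W \<and> card (U + W) < card U + card W)"
proof (rule disjCI)
  assume noW: "\<nexists>W. fragment 2 K' U W \<and> card (U + W) < card U + card W"
  have K'G: "finite_subgroup K'" and UK': "U \<subseteq> K'" using K' by (auto simp: generates_def)
  have UK: "U \<subseteq> K" using U(1) by (simp add: fragment_def)
  have K'K: "K' \<subseteq> K" using K' KG UK by (auto simp: generates_def)
  have finK: "finite K" and finK': "finite K'" using KG K'G by (auto simp: finite_subgroup_def)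
  have finB: "finite B" and finU: "finite U" using B UK finK by (auto intro: finite_subset)
  \<comment> \<open>Two different translates of \<open>U\<close> fit into \<open>K'\<close> and
    share at most one element. This makes \<open>K'\<close> large enough for the final count of
    holes.\<close>
  have cK': "2 * card U \<le> card K' + 1"
  proof -
    obtain g where g: "g \<in> U" "g \<noteq> 0"
    proof -
      have "\<not> U \<subseteq> {0}" using U(4) card_mono[of "{0::'a}" U] by auto
      then show thesis using that by blast
    qed
    have "(+) 0 ` U \<union> (+) g ` U \<subseteq> K'" using UK' g finite_subgroupD(3)[OF K'G] by auto
    then have "card ((+) 0 ` U \<union> (+) g ` U) \<le> card K'" using finK' by (rule card_mono[rotated])
    then show ?thesis using sidon_card_Un(1)[OF U(3) finU g(2)[symmetric]] by linarith
  qed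
  define \<C> where "\<C> = (\<lambda>x. (+) x ` K') ` B"
  have fin\<C>: "finite \<C>" using finB by (simp add: \<C>_def)
  \<comment> \<open>\<open>t\<close> measures how much a slice of \<open>B\<close> grows when
    \<open>U\<close> is added; the growths total at most |U| - 1. \<open>hole\<close> counts what
    the slice lacks to fill its coset.\<close>
  define t where "t = (\<lambda>C. int (card (B \<inter> C + U)) - int (card (B \<inter> C)))"
  define hole where "hole = (\<lambda>C. int (card K') - int (card (B \<inter> C)))"
  have sumB: "card B = (\<Sum>C\<in>\<C>. card (B \<inter> C))"
  proof -
    have "{0} \<subseteq> K'" using K'G by (simp add: finite_subgroup_def)
    from card_coset_sum[OF K'G finB this] show ?thesis by (simp add: \<C>_def)
  qed
  have sumt: "(\<Sum>C\<in>\<C>. t C) = int (card (B + U)) - int (card B)"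
    unfolding t_def sumB card_coset_sum[OF K'G finB UK'] \<C>_def[symmetric] by (simp add: sum_subtractf)
  have BK'C: "B \<inter> C + K' = C" "card C = card K'" "finite C" "B \<inter> C \<noteq> {}" if "C \<in> \<C>" for C
  proof -
    obtain x where x: "x \<in> B" "C = (+) x ` K'" using \<open>C \<in> \<C>\<close> by (auto simp: \<C>_def)
    show "card C = card K'" using x by simp
    show "finite C" using x finK' by simp
    have xC: "x \<in> B \<inter> C" using x K'G by (simp add: mem_coset finite_subgroup_def)
    then show "B \<inter> C \<noteq> {}" by blast
    have "B \<inter> C + K' \<subseteq> C + K'" by (intro set_plus_mono2) auto
    also have "C + K' = C"
      unfolding x(2) set_plus_translate_left subgroup_set_plus_self[OF K'G] ..
    finally have "B \<inter> C + K' \<subseteq> C" .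
    moreover have "C \<subseteq> B \<inter> C + K'"
      using xC unfolding x(2) by blast
    ultimately show "B \<inter> C + K' = C" by blast
  qed
  have sumhole: "(\<Sum>C\<in>\<C>. hole C) = int (card (B + K')) - int (card B)"
  proof -
    have "card (B + K') = (\<Sum>C\<in>\<C>. card K')"
      using card_coset_sum[OF K'G finB subset_refl] BK'C by (simp add: \<C>_def)
    then show ?thesis unfolding hole_def sumB by (simp add: sum_subtractf)
  qed
  have t_nonneg: "0 \<le> t C" if "C \<in> \<C>" for C
    using card_le_card_set_plus[OF finU, of "B \<inter> C"] finB U(5) unfolding t_def
    by (auto simp: add.commute)
  have t_le: "t C \<le> int (card U) - 1" if "C \<in> \<C>" for C
  proof -
    have "t C \<le> sum t \<C>" using that t_nonneg fin\<C> by (intro member_le_sum) auto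
    then show ?thesis using sumt U(2) by linarith
  qed
  have full: "hole C = 0" if C: "C \<in> \<C>" "t C = 0" for C
  proof -
    obtain x where x: "x \<in> B" "C = (+) x ` K'" using C by (auto simp: \<C>_def)
    have "B \<inter> C = C"
      using full_coset[OF K' U(5), of "B \<inter> C" x] C BK'C(4)[OF C(1)] finB by (auto simp: t_def x(2))
    then show ?thesis using BK'C(2)[OF C(1)] by (simp add: hole_def)
  qed
  \<comment> \<open>Here the roles are exchanged: a slice that is neither a single point nor almost
    full after adding \<open>U\<close> would, moved into \<open>K'\<close>, be a 2-fragment for
    \<open>U\<close> contradicting \<open>noW\<close>.\<close>
  have dichotomy: "card (B \<inter> C) = 1 \<or> card K' \<le> card (B \<inter> C + U) + 1" if C: "C \<in> \<C>" for C
  proof (rule ccontr)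
    assume neg: "\<not> ?thesis"
    obtain x where x: "x \<in> B" "C = (+) x ` K'" using C by (auto simp: \<C>_def)
    define W where "W = (+) (- x) ` (B \<inter> C)"
    have WK': "W \<subseteq> K'"
    proof
      fix w assume "w \<in> W"
      then obtain b where "b \<in> C" "w = - x + b" by (auto simp: W_def)
      then show "w \<in> K'" unfolding x(2) mem_coset by simp
    qed
    have cW: "card W = card (B \<inter> C)" unfolding W_def by (rule card_translate)
    have "U + W = (+) (- x) ` (B \<inter> C + U)"
      unfolding W_def set_plus_translate by (simp add: add.commute)
    then have cUW: "card (U + W) = card (B \<inter> C + U)" by (simp only: card_translate)
    have "card (B \<inter> C) \<noteq> 0" using BK'C(4)[OF C] finB by simp
    then have "fragment 2 K' U W"
      using neg WK' by (auto simp: fragment_def cW cUW)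
    moreover have "card (U + W) < card U + card W" using t_le[OF C] by (auto simp: t_def cW cUW)
    ultimately show False using noW by blast
  qed
  \<comment> \<open>A one-point slice grows by |U| - 1 and so uses up the whole growth; every other
    slice is full. Without one-point slices, each slice that grows has at most t + 1 <= 2t holes,
    which makes at most 2(|U| - 1) < |K'| in total by \<open>cK'\<close>.\<close>
  have key: "(\<Sum>C\<in>\<C>. hole C) < int (card K') \<and> K' \<noteq> K"
  proof (cases "\<exists>C\<in>\<C>. card (B \<inter> C) = 1")
    case True
    then obtain D b where D: "D \<in> \<C>" "B \<inter> D = {b}" by (metis card_1_singletonE)
    then have tD: "t D = int (card U) - 1" by (simp add: t_def insert_set_plus)
    have "(\<Sum>C\<in>\<C>. t C) = t D + (\<Sum>C\<in>\<C> - {D}. t C)" using D fin\<C> by (simp add: sum.remove)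
    then have "(\<Sum>C\<in>\<C> - {D}. t C) \<le> 0" using tD sumt U(2) by linarith
    then have "t C = 0" if "C \<in> \<C> - {D}" for C
      using member_le_sum[OF that, of t] t_nonneg that fin\<C> by fastforce
    then have "(\<Sum>C\<in>\<C> - {D}. hole C) = 0" using full by (intro sum.neutral) blast
    then have "(\<Sum>C\<in>\<C>. hole C) = hole D" using D fin\<C> by (simp add: sum.remove)
    moreover have "hole D = int (card K') - 1" using D by (simp add: hole_def)
    moreover have "K' \<noteq> K"
    proof
      assume "K' = K"
      obtain x where x: "x \<in> B" "D = (+) x ` K" using D(1) \<open>K' = K\<close> by (auto simp: \<C>_def)
      then have "B \<subseteq> D" using B(1) finite_subgroupD(5)[OF KG] by (auto simp: mem_coset subset_iff simp del: image_iff)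
      then have "B = {b}" using D(2) by blast
      then show False using B(2) by simp
    qed
    ultimately show ?thesis by simp
  next
    case False
    have "hole C \<le> 2 * t C" if "C \<in> \<C>" for C
    proof (cases "t C = 0")
      case True
      then show ?thesis using full[OF that] by simp
    next
      case t: False
      then have "1 \<le> t C" using t_nonneg[OF that] by simp
      moreover have "hole C \<le> t C + 1" using dichotomy[OF that] False that by (auto simp: hole_def t_def)
      ultimately show ?thesis by simp
    qed
    then have "(\<Sum>C\<in>\<C>. hole C) \<le> 2 * (\<Sum>C\<in>\<C>. t C)" by (simp add: sum_distrib_left sum_mono)
    then have "(\<Sum>C\<in>\<C>. hole C) < int (card K')" using sumt U(2) cK' by linarith
    moreover have "K' \<noteq> K"
    proof
      assume "K' = K"
      obtain x where x: "x \<in> B" using B(2) by fastforce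
      define D where "D = (+) x ` K'"
      have D: "D \<in> \<C>" using x by (simp add: \<C>_def D_def)
      have "B \<subseteq> D" using B(1) x finite_subgroupD(5)[OF KG] unfolding D_def \<open>K' = K\<close>
        by (auto simp: mem_coset subset_iff simp del: image_iff)
      then have "B \<inter> D = B" by blast
      then show False using dichotomy[OF D] False D U(1) \<open>K' = K\<close> by (auto simp: fragment_def)
    qed
    ultimately show ?thesis by simp
  qed
  moreover have "K' \<noteq> {0}" using UK' U(4) card_mono[OF finK' UK'] by auto
  ultimately show "critical_partner K B K'"
    using sumhole K'G K'K by (auto simp: critical_partner_def)
qed

lemma critical_partner_uminus:
  assumes K: "finite_subgroup K" and V: "critical_partner K (uminus ` A) V"
  shows "critical_partner K A (uminus ` V)"
proof -
  have "A + uminus ` V = uminus ` (uminus ` A + V)" by (simp add: uminus_image_set_plus image_image)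
  then have "card (A + uminus ` V) = card (uminus ` A + V)" by simp
  moreover have "uminus ` V \<subseteq> K" using V finite_subgroupD(4)[OF K] by (auto simp: critical_partner_def)
  ultimately show ?thesis using V by (auto simp: critical_partner_def uminus_image_subgroup)
qed

lemma generates_uminus:
  assumes "generates A K" shows "generates (uminus ` A) K"
  using assms finite_subgroupD(4) unfolding generates_def
  by (smt (verit, ccfv_threshold) image_subset_iff minus_minus subset_iff)

text \<open>A set \<open>B\<close> of two elements is its own partner. For |B| >= 3, a 2-atom
  through 0 that has two elements or a period is a partner; otherwise it is a Sidon set smaller than
  \<open>B\<close>, and induction applies to it in place of \<open>B\<close>.\<close>

lemma ex_critical_partner_atom:
  fixes B :: "'a::ab_group_add set"
  assumes IH: "\<And>(U::'a set) K' W. card U < card B \<Longrightarrow> generates U K' \<Longrightarrow> 0 \<in> U \<Longrightarrow> fragment 2 K' U W \<Longrightarrow>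
        card (U + W) < card U + card W \<Longrightarrow> \<exists>V. critical_partner K' U V"
    and K: "generates B K" and B0: "0 \<in> B"
    and A: "atom 2 K B U" "card (B + U) < card B + card U"
  shows "\<exists>V. critical_partner K B V"
proof -
  have KG: "finite_subgroup K" and BK: "B \<subseteq> K" using K by (auto simp: generates_def)
  have finK: "finite K" and finB: "finite B" using KG BK by (auto simp: finite_subgroup_def intro: finite_subset)
  have "card U \<ge> 2" "U \<subseteq> K" using A by (auto simp: atom_def fragment_def)
  then have "U \<noteq> {}" by auto
  then obtain u where u: "u \<in> U" "u \<in> K" using \<open>U \<subseteq> K\<close> by blast
  define T where "T = (+) (- u) ` U"
  have atom: "atom 2 K B T" unfolding T_def using atom_translate[OF KG finite_subgroupD(4)[OF KG u(2)] A(1)] .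
  have T0: "0 \<in> T" unfolding T_def mem_coset using u by simp
  have lt: "card (B + T) < card B + card T" using A(2) unfolding T_def set_plus_translate card_translate .
  have frag: "fragment 2 K B T" using atom by (simp add: atom_def)
  have TK: "T \<subseteq> K" and T2: "2 \<le> card T" using frag by (auto simp: fragment_def)
  have finT: "finite T" using TK finK by (rule finite_subset)
  have "card B \<noteq> 0" using B0 finB by auto
  then consider "card B = 1" | "card B = 2" | "card B \<ge> 3" by linarith
  then show ?thesis
  proof cases
    case 1
    then have "B = {0}" using B0 by (metis card_1_singletonE singletonD)
    moreover have "finite_subgroup {0::'a}" by (simp add: finite_subgroup_def)
    ultimately have "K \<subseteq> {0}" using K unfolding generates_def by blast
    then have "card K \<le> 1" using card_mono[of "{0::'a}" K] by simp
    moreover have "card T \<le> card K" using TK finK by (intro card_mono)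
    ultimately show ?thesis using T2 by simp
  next
    case 2
    then obtain d where d: "B = {0, d}" using B0 by (auto simp: card_2_iff doubleton_eq_iff)
    have "B + B \<subseteq> {0, d, d + d}" unfolding d by (auto elim!: set_plus_elim)
    then have "card (B + B) \<le> card {0, d, d + d}" by (intro card_mono) auto
    also have "\<dots> \<le> 3" by (simp add: card_insert_le_m1)
    finally have "critical_partner K B B" using 2 BK by (simp add: critical_partner_def)
    then show ?thesis by blast
  next
    case B3: 3
    show ?thesis
    proof (cases "card T = 2")
      case True
      then show ?thesis using TK lt by (auto simp: critical_partner_def)
    next
      case False
      then have T3: "3 \<le> card T" using T2 by simp
      \<comment> \<open>With a period g, which is then also an element of \<open>T\<close>, both u
        and g + u lie in \<open>T\<close> and in \<open>u + T\<close>, so the subgroup criterion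
        holds with k = 2. Without one, the intersection property leaves at most one common point,
        which is \<open>sidon\<close>.\<close>
      show ?thesis
      proof (cases "\<exists>g. g \<noteq> 0 \<and> (+) g ` T = T")
        case True
        then obtain g where g: "g \<noteq> 0" "(+) g ` T = T" by blast
        have gT: "g \<in> T" using T0 g(2) by force
        have "finite_subgroup T"
        proof (rule atom_subgroup[OF KG BK atom T0])
          fix u assume "u \<in> T"
          then have "{u, g + u} \<subseteq> T \<inter> (+) u ` T" using T0 gT g(2) by (force simp: mem_coset simp del: image_iff)
          moreover have "card {u, g + u} = 2" using g(1) by simp
          ultimately show "2 \<le> card (T \<inter> (+) u ` T)" using finT by (metis card_mono finite_Int)
        qed
        moreover have "T \<noteq> {0}" using T2 by auto
        moreover have "T \<noteq> K"
        proof
          assume "T = K"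
          then have "card K \<le> card (B + T)" using card_le_card_set_plus[OF finB finT] B0 by blast
          then show False using frag by (simp add: fragment_def)
        qed
        ultimately show ?thesis using TK lt by (auto simp: critical_partner_def)
      next
        case notper: False
        have sidon: "sidon T" unfolding sidon_def
        proof (intro allI impI)
          fix g :: 'a assume "g \<noteq> 0"
          show "card (T \<inter> (+) g ` T) \<le> 1"
          proof (cases "g \<in> K")
            case True
            then show ?thesis using atom_Int_translate[OF KG BK atom True] notper \<open>g \<noteq> 0\<close> by fastforce
          next
            case False
            have "T \<inter> (+) g ` T = {}"
            proof (rule ccontr)
              assume "T \<inter> (+) g ` T \<noteq> {}"
              then obtain x where "x \<in> T" "x - g \<in> T" by (metis disjoint_iff mem_coset)
              then have "x - (x - g) \<in> K" using TK finite_subgroupD(5)[OF KG] by blast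
              then show False using False by simp
            qed
            then show ?thesis by simp
          qed
        qed
        \<comment> \<open>3|T| - 3 <= |B + T| < |B| + |T|, and |T| >= 3.\<close>
        have "card T < card B" using sidon_card_sumset[OF sidon finT finB B3] lt T3 by linarith
        obtain K' where K': "generates T K'" using ex_generates[OF KG TK] by blast
        have "2 \<le> card B" using B3 by simp
        from sidon_atom_cases[OF KG BK this frag lt sidon T3 T0 K']
        show ?thesis
          using IH[OF \<open>card T < card B\<close> K' T0] sidon_no_critical_partner[OF sidon T3 T0 K'] by blast
      qed
    qed
  qed
qed

text \<open>The atom may belong to \<open>- A\<close>, which has the same size and generates the
  same subgroup; negating its partner gives one for \<open>A\<close>.\<close>

lemma ex_critical_partner:
  fixes A :: "'a::ab_group_add set"
  assumes "generates A K" "0 \<in> A" "fragment 2 K A U" "card (A + U) < card A + card U"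
  shows "\<exists>V. critical_partner K A V"
  using assms
proof (induction "card A" arbitrary: A K U rule: less_induct)
  case less
  have KG: "finite_subgroup K" and AK: "A \<subseteq> K" using less.prems(1) by (auto simp: generates_def)
  obtain B V where B: "B = A \<or> B = uminus ` A" and V: "atom 2 K B V"
    using ex_atom[OF KG AK _ less.prems(3)] less.prems(2) by blast
  have cB: "card B = card A" using B by auto
  have "A \<in> {B, uminus ` B}" using B by (auto simp: image_image)
  then have "excess B V \<le> excess A U" using V less.prems(3) by (auto simp: atom_def)
  then have "card (B + V) < card B + card V" using less.prems(4) by (simp add: excess_def cB)
  moreover have "generates B K" using B less.prems(1) generates_uminus by blast
  moreover have "0 \<in> B" using B less.prems(2) by force
  moreover have "\<exists>V. critical_partner K' U V"
    if "card U < card B" "generates U K'" "0 \<in> U" "fragment 2 K' U W" "card (U + W) < card U + card W"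
    for U :: "'a set" and K' W
    using less.hyps[OF that(1)[unfolded cB] that(2-5)] .
  ultimately have "\<exists>V. critical_partner K B V" using ex_critical_partner_atom V by metis
  then show ?case using B critical_partner_uminus[OF KG] by blast
qed

section \<open>Sumsets of size at most $2|A| - 1$\<close>

text \<open>All of \<open>S\<close> in the coset \<open>s + H\<close> is taken out, which
  corresponds to the largest choice of S'' in \<open>quasi_periodic_set\<close>.\<close>

definition quasi_periodic :: "'a::ab_group_add set \<Rightarrow> bool" where
  "quasi_periodic S \<longleftrightarrow> (\<exists>H s. finite_subgroup H \<and> H \<noteq> {0} \<and> s \<in> S \<and> \<not> (+) s ` H \<subseteq> S \<and>
     S - (+) s ` H \<noteq> {} \<and> (S - (+) s ` H) + H = S - (+) s ` H)"

definition arith_prog :: "'a::ab_group_add set \<Rightarrow> bool" where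
  "arith_prog S \<longleftrightarrow> (\<exists>a d n. S = (\<lambda>j. ((+) d ^^ j) a) ` {..<n})"

lemma quasi_periodicI:
  assumes H: "finite_subgroup H" "H \<noteq> {0}" and s: "s \<in> S" "z - s \<in> H" "z \<notin> S"
    and x: "x \<in> S" "x - s \<notin> H"
    and closed: "\<And>w h. w \<in> S \<Longrightarrow> w - s \<notin> H \<Longrightarrow> h \<in> H \<Longrightarrow> w + h \<in> S"
  shows "quasi_periodic S"
proof -
  have "(S - (+) s ` H) + H \<subseteq> S - (+) s ` H"
  proof
    fix v assume "v \<in> (S - (+) s ` H) + H"
    then obtain w h where w: "w \<in> S - (+) s ` H" "h \<in> H" "v = w + h" by (metis set_plus_elim)
    then have ws: "w \<in> S" "w - s \<notin> H" by (metis Diff_iff mem_coset)+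
    have "v - s \<notin> H"
    proof
      assume "v - s \<in> H"
      then have "v - s - h \<in> H" using w(2) finite_subgroupD(5)[OF H(1)] by blast
      then show False using ws(2) w(3) by (simp add: algebra_simps)
    qed
    then show "v \<in> S - (+) s ` H" using closed[OF ws w(2)] w(3) by (metis Diff_iff mem_coset)
  qed
  then have "(S - (+) s ` H) + H = S - (+) s ` H" using subset_set_plus_subgroup[OF H(1)] by blast
  moreover have "\<not> (+) s ` H \<subseteq> S" using s mem_coset by blast
  moreover have "x \<in> S - (+) s ` H" using x by (metis Diff_iff mem_coset)
  ultimately show ?thesis using H s(1) unfolding quasi_periodic_def by blast
qed

text \<open>The only defective coset 2c + H plays the part of \<open>s + H\<close>. It cannot
  contain all of \<open>A + A\<close>: as 0 lies in \<open>A\<close>, each x in \<open>A\<close>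
  would be a difference of two elements of 2c + H, hence in \<open>H\<close>.\<close>

lemma quasi_periodic_sumset:
  assumes H: "finite_subgroup H" "H \<noteq> {0}" and A: "finite A" "0 \<in> A" "\<not> A \<subseteq> H"
    and card: "card (A + H) < card A + card H" and aper: "\<not> periodic (A + A)"
  shows "quasi_periodic (A + A)"
proof -
  obtain z where z: "z \<in> A + A + H" "z \<notin> A + A" using ex_missing_element[OF H aper] .
  obtain c where c: "c \<in> A"
    and miss: "\<And>w. w \<in> A + A + H \<Longrightarrow> w \<notin> A + A \<Longrightarrow> w - (c + c) \<in> H"
    using sumset_nearly_periodic[OF H(1) A(1) card z] by metis
  have "\<exists>x\<in>A + A. x - (c + c) \<notin> H"
  proof (rule ccontr)
    assume "\<not> ?thesis"
    then have in_H: "\<And>x. x \<in> A + A \<Longrightarrow> x - (c + c) \<in> H" by blast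
    have "x \<in> H" if "x \<in> A" for x
    proof -
      have "(0 + x - (c + c)) - (0 + 0 - (c + c)) \<in> H"
        using finite_subgroupD(5)[OF H(1)] in_H A(2) that by blast
      then show ?thesis by simp
    qed
    then show False using A(3) by blast
  qed
  then obtain x where x: "x \<in> A + A" "x - (c + c) \<notin> H" by blast
  show ?thesis
  proof (rule quasi_periodicI[OF H _ miss[OF z] z(2) x])
    show "c + c \<in> A + A" using c by blast
    fix w h assume w: "w \<in> A + A" "w - (c + c) \<notin> H" "h \<in> H"
    show "w + h \<in> A + A"
    proof (rule ccontr)
      assume "w + h \<notin> A + A"
      then have "w + h - (c + c) - h \<in> H" using miss w finite_subgroupD(5)[OF H(1)] by blast
      then show False using w(2) by (simp add: algebra_simps)
    qed
  qed
qed

section \<open>From a two-element partner to an arithmetic progression\<close>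

text \<open>Only one element \<open>a\<close> of \<open>A\<close> lacks its predecessor a - d. The
  chain a, a + d, ... inside \<open>A\<close> is a progression, and the rest \<open>R\<close> is
  invariant under \<open>d\<close>. If \<open>R\<close> is non-empty, the subgroup generated by
  \<open>d\<close> is a partner, since all holes of \<open>A\<close> lie in the single coset a +
  H.\<close>

lemma arith_prog_or_partner:
  assumes K: "finite_subgroup K" "A \<subseteq> K" "d \<in> K" and d: "d \<noteq> 0"
    and card: "card (A \<union> (+) d ` A) \<le> card A + 1" and aper: "\<not> periodic A"
  shows "arith_prog A \<or> (\<exists>H. finite_subgroup H \<and> H \<noteq> {0} \<and> \<not> A \<subseteq> H \<and> card (A + H) < card A + card H)"
proof -
  have finA: "finite A" using K by (auto simp: finite_subgroup_def intro: finite_subset)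
  have "card ((+) d ` A \<union> A) = card ((+) d ` A) + card (A - (+) d ` A)"
    using finA by (subst card_Un_disjoint[symmetric]) auto
  then have "card (A - (+) d ` A) \<le> 1" using card by (simp add: Un_commute)
  moreover have "A - (+) d ` A \<noteq> {}"
  proof
    assume "A - (+) d ` A = {}"
    then have "(+) d ` A = A" using finA by (intro card_subset_eq[symmetric]) auto
    then show False using aper d unfolding periodic_def by (metis order_refl)
  qed
  ultimately have "card (A - (+) d ` A) = 1" using finA by (metis card_0_eq finite_Diff le_less_Suc_eq le_neq_implies_less less_one One_nat_def)
  then obtain a where a: "A - (+) d ` A = {a}" by (metis card_1_singletonE)
  then have aA: "a \<in> A" "a - d \<notin> A" using mem_coset[of a d A] by auto
  have pred: "b - d \<in> A" if "b \<in> A" "b \<noteq> a" for b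
    using a that mem_coset[of b d A] by blast
  define f where "f = (\<lambda>j. ((+) d ^^ j) a)"
  have f_simps: "f 0 = a" "f (Suc j) = d + f j" for j by (simp_all add: f_def)
  \<comment> \<open>A chain that never leaves \<open>A\<close> would be a finite set closed under
    adding \<open>d\<close>, hence under subtracting it, and would contain a - d.\<close>
  have "\<exists>m. f m \<notin> A"
  proof (rule ccontr)
    assume "\<not> ?thesis"
    then have "range f \<subseteq> A" by blast
    moreover from this have "finite (range f)" using finA by (rule finite_subset)
    moreover have "(+) d ` range f \<subseteq> range f" by (auto simp: f_simps(2)[symmetric])
    ultimately have "(+) d ` range f = range f" by (intro translate_subset_eq)
    then have "a \<in> (+) d ` range f" by (metis f_simps(1) rangeI)
    then have "a - d \<in> range f" by (simp only: mem_coset)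
    then show False using aA(2) \<open>range f \<subseteq> A\<close> by blast
  qed
  define m where "m = (LEAST m. f m \<notin> A)"
  have fm: "f m \<notin> A" unfolding m_def using \<open>\<exists>m. f m \<notin> A\<close> by (rule LeastI_ex)
  have fj: "f j \<in> A" if "j < m" for j using not_less_Least[of j "\<lambda>m. f m \<notin> A"] that unfolding m_def by simp
  define R where "R = A - f ` {..<m}"
  have "0 < m" using fm aA(1) f_simps(1) by (metis gr0I)
  then have aR: "a \<notin> R" unfolding R_def using f_simps(1) by (metis Diff_iff imageI lessThan_iff)
  \<comment> \<open>A predecessor in the chain would make b the next element of the chain, or
    \<open>f m\<close>, which is outside \<open>A\<close>.\<close>
  have "(+) (- d) ` R \<subseteq> R"
  proof (rule image_subsetI)
    fix b assume b: "b \<in> R"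
    then have "b - d \<in> A" using pred aR by (metis DiffD1 R_def)
    moreover have "b - d \<notin> f ` {..<m}"
    proof
      assume "b - d \<in> f ` {..<m}"
      then obtain j where j: "j < m" "b - d = f j" by blast
      then have b_eq: "b = f (Suc j)" using f_simps(2)[of j] by (metis add.commute diff_add_cancel)
      then have "Suc j \<noteq> m" using b fm by (auto simp: R_def)
      then show False using b b_eq j(1) by (auto simp: R_def)
    qed
    ultimately show "- d + b \<in> R" by (simp add: R_def)
  qed
  then have Rd: "(+) (- d) ` R = R" using finA by (intro translate_subset_eq) (simp_all add: R_def)
  have dR: "(+) d ` R \<subseteq> R"
  proof (rule image_subsetI)
    fix b assume "b \<in> R"
    then have "b \<in> (+) (- d) ` R" using Rd by simp
    then show "d + b \<in> R" by (simp only: mem_coset) (simp add: add.commute)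
  qed
  show ?thesis
  proof (cases "R = {}")
    case True
    then have "A = f ` {..<m}" using fj by (auto simp: R_def)
    then show ?thesis unfolding arith_prog_def f_def by blast
  next
    case False
    have "{d} \<subseteq> K" using K by simp
    then obtain H where H: "generates {d} H" by (rule ex_generates[OF K(1)])
    then have HG: "finite_subgroup H" and dH: "d \<in> H" by (auto simp: generates_def)
    let ?S = "{h \<in> H. (+) h ` R \<subseteq> R}"
    have "finite_subgroup ?S" by (rule finite_subgroup_stabilizer[OF HG])
    moreover have "{d} \<subseteq> ?S" using dH dR by simp
    ultimately have stab: "H \<subseteq> ?S" using H by (auto simp: generates_def)
    have coset: "y \<in> R" if "x \<in> R" "y - x \<in> H" for x y
    proof -
      have "(y - x) + x \<in> R" using stab that by blast
      then show ?thesis by simp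
    qed
    have "\<not> A \<subseteq> H"
    proof
      assume AH: "A \<subseteq> H"
      obtain x where "x \<in> R" using False by blast
      then have "a \<in> H" "x \<in> H" using aA(1) AH by (auto simp: R_def)
      then have "a - x \<in> H" by (rule finite_subgroupD(5)[OF HG])
      then show False using coset \<open>x \<in> R\<close> aR by blast
    qed
    moreover have "card (A + H) < card A + card H"
    proof -
      have fH: "f j - a \<in> H" for j
      proof (induction j)
        case 0
        then show ?case using HG by (simp add: f_simps finite_subgroup_def)
      next
        case (Suc j)
        then have "d + (f j - a) \<in> H" using dH finite_subgroupD(3)[OF HG] by blast
        then show ?case by (simp add: f_simps algebra_simps)
      qed
      have "A + H \<subseteq> R \<union> (+) a ` H"
      proof
        fix w assume "w \<in> A + H"
        then obtain b h where bh: "b \<in> A" "h \<in> H" "w = b + h" by (metis set_plus_elim)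
        show "w \<in> R \<union> (+) a ` H"
        proof (cases "b \<in> R")
          case True
          then show ?thesis using coset[of b w] bh by simp
        next
          case False
          then have "b - a \<in> H" using bh(1) fH by (auto simp: R_def)
          then have "b - a + h \<in> H" using bh(2) finite_subgroupD(3)[OF HG] by blast
          then have "w \<in> (+) a ` H" unfolding mem_coset bh(3) by (simp add: algebra_simps)
          then show ?thesis by blast
        qed
      qed
      then have "card (A + H) \<le> card (R \<union> (+) a ` H)"
        using finA HG by (intro card_mono) (auto simp: R_def finite_subgroup_def)
      also have "\<dots> \<le> card R + card H" using card_Un_le[of R "(+) a ` H"] by simp
      also have "card R < card A" using aA(1) aR finA by (intro psubset_card_mono) (auto simp: R_def)
      finally show ?thesis by simp
    qed
    moreover have "H \<noteq> {0}" using dH d by blast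
    ultimately show ?thesis using HG by blast
  qed
qed

section \<open>Sumsets that miss one element of the group\<close>

lemma even_card_involution:
  assumes "finite S" "\<And>x. x \<in> S \<Longrightarrow> f x \<in> S \<and> f x \<noteq> x \<and> f (f x) = x"
  shows "even (card S)"
  using assms
proof (induction "card S" arbitrary: S rule: less_induct)
  case less
  show ?case
  proof (cases "S = {}")
    case False
    then obtain x where x: "x \<in> S" by blast
    note fx = less.prems(2)[OF x]
    let ?S = "S - {x, f x}"
    have card: "card S = card ?S + 2"
      using x fx less.prems(1) card_Diff_subset[of "{x, f x}" S] card_mono[of S "{x, f x}"] by auto
    have "f y \<in> ?S \<and> f y \<noteq> y \<and> f (f y) = y" if "y \<in> ?S" for y
      using less.prems(2)[of y] fx that by auto
    then have "even (card ?S)" using less.hyps[of ?S] less.prems(1) card by simp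
    then show ?thesis using card by simp
  qed simp
qed

text \<open>The non-zero elements are odd in number, so negation cannot pair them off without a
  fixed point.\<close>

lemma ex_order_two:
  assumes K: "finite_subgroup K" and even: "even (card K)"
  obtains h where "h \<in> K" "h \<noteq> 0" "h + h = 0"
proof -
  have "\<exists>h\<in>K. h \<noteq> 0 \<and> h + h = 0"
  proof (rule ccontr)
    assume neg: "\<not> ?thesis"
    have "- x \<noteq> x" if "x \<in> K - {0}" for x using neg that by (metis Diff_iff ab_left_minus insertI1)
    then have "even (card (K - {0}))" using finite_subgroupD(1,4)[OF K]
      by (intro even_card_involution[of _ uminus]) auto
    moreover have "card K = Suc (card (K - {0}))"
      using finite_subgroupD(1,2)[OF K] by (metis card.remove)
    ultimately show False using even by simp
  qed
  then show thesis using that by blast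
qed

lemma quasi_periodic_cofinite:
  assumes K: "finite_subgroup K" and A: "A \<subseteq> K" "2 \<le> card A" "A + A \<noteq> K"
    and card: "card K \<le> card (A + A) + 1" "card (A + A) + 1 \<le> 2 * card A"
  shows "quasi_periodic (A + A)"
proof -
  have finK: "finite K" using K by (simp add: finite_subgroup_def)
  have AA: "A + A \<subseteq> K" by (rule subgroup_set_plus_subset[OF K A(1,1)])
  then have "card (A + A) < card K" using A(3) finK by (intro psubset_card_mono) auto
  then have "card (K - (A + A)) = 1" using card(1) AA finK by (simp add: card_Diff_subset finite_subset)
  then obtain x where x: "K - (A + A) = {x}" by (metis card_1_singletonE)
  then have AA_iff: "w \<in> A + A \<longleftrightarrow> w \<in> K \<and> w \<noteq> x" for w using AA by blast
  have xK: "x \<in> K" using x by blast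
  \<comment> \<open>As \<open>x\<close> is not a sum, pigeonhole gives 2|A| <= |K|; the two size
    hypotheses give the converse.\<close>
  have "card A + card A \<le> card K"
  proof (rule ccontr)
    assume "\<not> ?thesis"
    then have "x \<in> A + A" using A(1) xK by (intro sumset_contains_coset[OF K, of A 0 A 0]) auto
    then show False using AA_iff by blast
  qed
  then have cK: "card K = 2 * card A" using card by simp
  then obtain h where h: "h \<in> K" "h \<noteq> 0" "h + h = 0" using ex_order_two[OF K] by auto
  have neg: "- h = h" using h(3) by (simp add: neg_eq_iff_add_eq_0)
  have H: "finite_subgroup {0, h}" using h(3) by (simp add: finite_subgroup_def)
  \<comment> \<open>|K| = 2|A| >= 4 leaves an element outside the defective coset {x, x + h}, so the
    periodic part is non-empty.\<close>
  have "card {x, x + h} = 2" using h(2) by simp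
  then have "\<not> K \<subseteq> {x, x + h}" using cK A(2) card_mono[of "{x, x + h}" K] by auto
  then obtain y where y: "y \<in> K" "y \<noteq> x" "y \<noteq> x + h" by blast
  show ?thesis
  proof (rule quasi_periodicI[OF H])
    show "x + h \<in> A + A" using AA_iff h xK finite_subgroupD(3)[OF K] by auto
    show "x - (x + h) \<in> {0, h}" using neg by simp
    show "x \<notin> A + A" using AA_iff by blast
    show "y \<in> A + A" using AA_iff y by blast
    show "y - (x + h) \<notin> {0, h}" using y h(3) by (auto simp: algebra_simps)
    fix w k assume w: "w \<in> A + A" "w - (x + h) \<notin> {0, h}" "k \<in> {0, h}"
    have "w + h \<noteq> x"
    proof
      assume "w + h = x"
      then have "w = x - h" by (simp add: algebra_simps)
      then have "w = x + h" using neg by (metis diff_conv_add_uminus)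
      then show False using w(2) by simp
    qed
    then show "w + k \<in> A + A" using AA_iff w h(1) finite_subgroupD(3)[OF K] by auto
  qed (use h in auto)
qed

lemma arith_prog_translate:
  assumes "arith_prog S" shows "arith_prog ((+) g ` S)"
proof -
  obtain a d n where S: "S = (\<lambda>j. ((+) d ^^ j) a) ` {..<n}" using assms by (auto simp: arith_prog_def)
  have "g + ((+) d ^^ j) a = ((+) d ^^ j) (g + a)" for j by (induction j) (auto simp: add.left_commute)
  then have "(+) g ` S = (\<lambda>j. ((+) d ^^ j) (g + a)) ` {..<n}" by (simp add: S image_image)
  then show ?thesis unfolding arith_prog_def by blast
qed

lemma quasi_periodic_translate:
  assumes "quasi_periodic S" shows "quasi_periodic ((+) g ` S)"
proof -
  obtain H s where *: "finite_subgroup H" "H \<noteq> {0}" "s \<in> S" "\<not> (+) s ` H \<subseteq> S"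
    "S - (+) s ` H \<noteq> {}" "(S - (+) s ` H) + H = S - (+) s ` H"
    using assms by (auto simp: quasi_periodic_def)
  have coset: "(+) (g + s) ` H = (+) g ` (+) s ` H" by (simp add: image_image add.assoc)
  have diff: "(+) g ` S - (+) (g + s) ` H = (+) g ` (S - (+) s ` H)"
    unfolding coset by (simp add: image_set_diff)
  show ?thesis unfolding quasi_periodic_def
  proof (intro exI conjI)
    show "g + s \<in> (+) g ` S" using *(3) by blast
    show "\<not> (+) (g + s) ` H \<subseteq> (+) g ` S" using *(4) unfolding coset by (simp add: inj_image_subset_iff)
    show "(+) g ` S - (+) (g + s) ` H \<noteq> {}" unfolding diff using *(5) by simp
    show "((+) g ` S - (+) (g + s) ` H) + H = (+) g ` S - (+) (g + s) ` H"
      unfolding diff set_plus_translate_left *(6) ..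
  qed (use * in auto)
qed

text \<open>When there is room for a 2-fragment, \<open>A\<close> itself is one, and its small
  sumset starts the isoperimetric argument.\<close>

lemma kemperman_aux:
  assumes K: "generates A K" and A: "0 \<in> A" "2 \<le> card A"
    and aper: "\<not> periodic (A + A)" and card: "card (A + A) + 1 \<le> 2 * card A"
  shows "quasi_periodic (A + A) \<or> arith_prog A"
proof -
  have KG: "finite_subgroup K" and AK: "A \<subseteq> K" using K by (auto simp: generates_def)
  have finA: "finite A" using AK KG by (auto simp: finite_subgroup_def intro: finite_subset)
  have "K \<noteq> {0}" using AK A(2) card_mono[of "{0}" A] by (auto simp: subset_singleton_iff)
  then have ne: "A + A \<noteq> K" using aper periodic_subgroup[OF KG] by auto
  show ?thesis
  proof (cases "card (A + A) + 2 \<le> card K")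
    case False
    then show ?thesis using quasi_periodic_cofinite[OF KG AK A(2) ne] card by simp
  next
    case True
    then have "fragment 2 K A A" using AK A by (simp add: fragment_def)
    then obtain V where V: "critical_partner K A V"
      using ex_critical_partner[OF K A(1)] card by fastforce
    show ?thesis
    proof (cases "card V = 2")
      case False
      then have H: "finite_subgroup V" "V \<noteq> {0}" "V \<noteq> K" "V \<subseteq> K" "card (A + V) < card A + card V"
        using V by (auto simp: critical_partner_def)
      then have "\<not> A \<subseteq> V" using K by (auto simp: generates_def)
      then show ?thesis using quasi_periodic_sumset[OF H(1,2) finA A(1) _ H(5) aper] by blast
    next
      case True
      then obtain x y where xy: "V = {x, y}" "x \<noteq> y" by (auto simp: card_2_iff)
      have aperA: "\<not> periodic A"
      proof
        assume "periodic A"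
        then obtain g where g: "g \<noteq> 0" "(+) g ` A \<subseteq> A" by (auto simp: periodic_def)
        then have "(+) g ` (A + A) \<subseteq> A + A"
          unfolding set_plus_translate_left[symmetric] by (intro set_plus_mono2) auto
        then show False using aper g(1) by (auto simp: periodic_def)
      qed
      have "A + V = (+) x ` (A \<union> (+) (y - x) ` A)"
        by (simp add: xy set_plus_insert image_Un image_image add.assoc[symmetric] Un_commute)
      then have "card (A \<union> (+) (y - x) ` A) = card (A + V)" by (simp only: card_translate)
      then have c: "card (A \<union> (+) (y - x) ` A) \<le> card A + 1" using V True by (simp add: critical_partner_def)
      have "y - x \<in> K" using V xy finite_subgroupD(5)[OF KG] by (auto simp: critical_partner_def)
      from arith_prog_or_partner[OF KG AK this _ c aperA] xy(2)
      show ?thesis using quasi_periodic_sumset[OF _ _ finA A(1) _ _ aper] by auto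
    qed
  qed
qed

lemma quasi_periodic_sumset_or_arith_prog:
  fixes A :: "'a::ab_group_add set"
  assumes G: "finite_subgroup G" "A \<subseteq> G" and A: "2 \<le> card A"
    and aper: "\<not> periodic (A + A)" and card: "card (A + A) + 1 \<le> 2 * card A"
  shows "quasi_periodic (A + A) \<or> arith_prog A"
proof -
  have "A \<noteq> {}" using A by auto
  then obtain a where a: "a \<in> A" by blast
  define B where "B = (+) (- a) ` A"
  have B0: "0 \<in> B" unfolding B_def mem_coset using a by simp
  have BG: "B \<subseteq> G" using a G(2) finite_subgroupD(5)[OF G(1)] by (auto simp: B_def)
  obtain K where K: "generates B K" by (rule ex_generates[OF G(1) BG])
  have BB: "B + B = (+) (- a) ` (+) (- a) ` (A + A)"
    by (simp only: B_def set_plus_translate set_plus_translate_left)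
  have AB: "A = (+) a ` B" by (simp add: B_def image_image)
  have AABB: "A + A = (+) a ` (+) a ` (B + B)"
    by (subst (1 2) AB) (simp only: set_plus_translate set_plus_translate_left)
  have "card B = card A" unfolding B_def by (rule card_translate)
  moreover have "\<not> periodic (B + B)" using aper by (simp only: BB periodic_translate not_False_eq_True)
  moreover have "card (B + B) = card (A + A)" by (simp only: BB card_translate)
  ultimately have "quasi_periodic (B + B) \<or> arith_prog B"
    using A card by (intro kemperman_aux[OF K B0]) auto
  then show ?thesis unfolding AABB using AB quasi_periodic_translate arith_prog_translate by metis
qed

section \<open>Residues modulo \<open>q\<close>\<close>

text \<open>The type \<open>rat_mod_int\<close> is the group $\mathbb{Q}/\mathbb{Z}$. It contains a copy of every finite
  cyclic group, which makes the type class results above available for an arbitrary modulus.\<close>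

quotient_type rat_mod_int = rat / "\<lambda>x y. x - y \<in> \<int>"
proof (rule equivpI)
  show "reflp (\<lambda>x y::rat. x - y \<in> \<int>)" by (simp add: reflp_def)
  show "symp (\<lambda>x y::rat. x - y \<in> \<int>)" by (auto intro!: sympI dest: Ints_minus)
  show "transp (\<lambda>x y::rat. x - y \<in> \<int>)"
  proof (rule transpI)
    fix x y z :: rat assume "x - y \<in> \<int>" "y - z \<in> \<int>"
    then have "(x - y) + (y - z) \<in> \<int>" by (rule Ints_add)
    then show "x - z \<in> \<int>" by simp
  qed
qed

instantiation rat_mod_int :: ab_group_add
begin

lift_definition zero_rat_mod_int :: rat_mod_int is 0 .

lift_definition plus_rat_mod_int :: "rat_mod_int \<Rightarrow> rat_mod_int \<Rightarrow> rat_mod_int" is "(+)"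
  using Ints_add by (fastforce simp: algebra_simps)

lift_definition uminus_rat_mod_int :: "rat_mod_int \<Rightarrow> rat_mod_int" is uminus
  by (auto dest: Ints_minus)

lift_definition minus_rat_mod_int :: "rat_mod_int \<Rightarrow> rat_mod_int \<Rightarrow> rat_mod_int" is "(-)"
  using Ints_diff by (fastforce simp: algebra_simps)

instance by standard (transfer; simp)+

end

lift_definition rat_class :: "rat \<Rightarrow> rat_mod_int" is "\<lambda>x. x" .

definition embed :: "nat \<Rightarrow> int \<Rightarrow> rat_mod_int" where
  "embed q k = rat_class (of_int k / of_nat q)"

lemma embed_add: "embed q (x + y) = embed q x + embed q y"
  unfolding embed_def by transfer (simp add: add_divide_distrib)

lemma embed_diff: "embed q (x - y) = embed q x - embed q y"
  unfolding embed_def by transfer (simp add: diff_divide_distrib)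

lemma embed_0 [simp]: "embed q 0 = 0"
  unfolding embed_def by transfer simp

lemma embed_eq_iff:
  assumes "q > 0" shows "embed q x = embed q y \<longleftrightarrow> x mod int q = y mod int q"
proof -
  have "embed q x = embed q y \<longleftrightarrow> of_int x / of_nat q - of_int y / of_nat q \<in> (\<int> :: rat set)"
    unfolding embed_def by transfer simp
  also have "\<dots> \<longleftrightarrow> (\<exists>k. of_int (x - y) = (of_int (int q * k) :: rat))"
    using assms by (auto simp: Ints_def diff_divide_distrib[symmetric] divide_eq_eq mult.commute)
  also have "\<dots> \<longleftrightarrow> int q dvd x - y" unfolding of_int_eq_iff dvd_def ..
  finally show ?thesis by (simp add: mod_eq_dvd_iff)
qed

lemma embed_mod [simp]: "q > 0 \<Longrightarrow> embed q (x mod int q) = embed q x"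
  by (simp add: embed_eq_iff)

lemma inj_on_embed: "q > 0 \<Longrightarrow> inj_on (embed q) {0..<int q}"
  by (auto simp: inj_on_def embed_eq_iff)

lemma mod_mem_iff_embed:
  assumes "q > 0" "T \<subseteq> {0..<int q}"
  shows "x mod int q \<in> T \<longleftrightarrow> embed q x \<in> embed q ` T"
proof -
  have "x mod int q \<in> {0..<int q}" using assms by simp
  then have "x mod int q \<in> T \<longleftrightarrow> embed q (x mod int q) \<in> embed q ` T"
    using inj_on_image_mem_iff[OF inj_on_embed] assms by blast
  then show ?thesis using assms by simp
qed

lemma embed_set_mult:
  assumes "q > 0" shows "embed q ` (R <#>\<^bsub>integer_mod_group q\<^esub> S) = embed q ` R + embed q ` S"
  using assms by (force simp: set_mult_def embed_add image_UN elim!: set_plus_elim)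

lemma set_mult_subset:
  assumes "q > 0" shows "R <#>\<^bsub>integer_mod_group q\<^esub> S \<subseteq> {0..<int q}"
  using assms by (auto simp: set_mult_def)

lemma card_embed_image:
  assumes "q > 0" "T \<subseteq> {0..<int q}" shows "card (embed q ` T) = card T"
  using assms by (meson card_image inj_on_embed inj_on_subset)

lemma finite_subgroup_embed:
  assumes "q > 0" shows "finite_subgroup (embed q ` {0..<int q})"
proof -
  have "embed q x + embed q y \<in> embed q ` {0..<int q}" for x y
    using assms by (metis atLeastLessThan_iff embed_add embed_mod imageI of_nat_0_less_iff
        pos_mod_bound pos_mod_sign)
  moreover have "0 \<in> embed q ` {0..<int q}" using assms by (force simp: image_iff)
  ultimately show ?thesis by (auto simp: finite_subgroup_def)
qed

text \<open>The group Q/Z is far larger than the image of the residues, but a period of a non-empty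
  image is a difference of two of its elements and so comes from a residue.\<close>

lemma periodic_set_embed:
  assumes q: "q > 0" and T: "T \<subseteq> {0..<int q}" "T \<noteq> {}" and per: "periodic (embed q ` T)"
  shows "periodic_set (integer_mod_group q) T"
proof -
  obtain g where g0: "g \<noteq> 0" and sub: "(+) g ` embed q ` T \<subseteq> embed q ` T"
    using per by (auto simp: periodic_def)
  have gT: "g + embed q x \<in> embed q ` T" if "x \<in> T" for x
    using sub that by (simp add: image_subset_iff)
  obtain s t where st: "s \<in> T" "g + embed q s = embed q t" using T(2) gT by blast
  define d where "d = (t - s) mod int q"
  have "g = embed q d" using q st(2) by (simp add: d_def embed_diff algebra_simps)
  moreover have "d \<in> {0..<int q}" using q by (simp add: d_def)
  moreover have "d \<noteq> 0" using calculation(1) g0 by auto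
  ultimately have d: "g = embed q d" "d \<in> {0..<int q}" "d \<noteq> 0" by blast+
  have "(x + d) mod int q \<in> T" if "x \<in> T" for x
    unfolding mod_mem_iff_embed[OF q T(1)] embed_add using gT[OF that] d(1) by (simp add: add.commute)
  then show ?thesis using d q
    by (auto simp: periodic_set_def r_coset_def carrier_integer_mod_group)
qed

text \<open>\<open>H\<close> is a priori just a subgroup of Q/Z. Adding h to a point of the
  non-empty periodic part stays in the image of \<open>T\<close>, so h is a difference of embedded
  residues and \<open>H\<close> pulls back to \<open>K\<close>.\<close>

lemma quasi_periodic_set_embed:
  assumes q: "q > 0" and T: "T \<subseteq> {0..<int q}" and aper: "\<not> periodic_set (integer_mod_group q) T"
    and qp: "quasi_periodic (embed q ` T)"
  shows "quasi_periodic_set (integer_mod_group q) T"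
proof -
  let ?G = "integer_mod_group q" and ?e = "embed q"
  obtain H s' where H: "finite_subgroup H" "H \<noteq> {0}" "s' \<in> ?e ` T" "\<not> (+) s' ` H \<subseteq> ?e ` T"
    "?e ` T - (+) s' ` H \<noteq> {}" "(?e ` T - (+) s' ` H) + H = ?e ` T - (+) s' ` H"
    using qp by (auto simp: quasi_periodic_def)
  obtain s where s: "s \<in> T" "s' = ?e s" using H(3) by blast
  define P where "P = {t \<in> T. ?e t - ?e s \<notin> H}"
  have P: "?e ` T - (+) s' ` H = ?e ` P"
    unfolding P_def s(2) by (auto simp: mem_coset simp del: image_iff)
  have P_H: "?e t + h \<in> ?e ` P" if "t \<in> P" "h \<in> H" for t h
    using H(6) that unfolding P by blast
  obtain p where p: "p \<in> P" using H(5) P by blast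
  define K where "K = {k \<in> {0..<int q}. ?e k \<in> H}"
  have mod_K: "k mod int q \<in> K \<longleftrightarrow> ?e k \<in> H" for k using q by (simp add: K_def)
  have H_K: "\<exists>k\<in>K. h = ?e k" if "h \<in> H" for h
  proof -
    obtain t where "?e p + h = ?e t" using P_H[OF p \<open>h \<in> H\<close>] by blast
    then have "h = ?e (t - p)" by (simp add: embed_diff algebra_simps)
    then have "(t - p) mod int q \<in> K" "h = ?e ((t - p) mod int q)" using mod_K that q by auto
    then show ?thesis by blast
  qed
  have K0: "0 \<in> K" using finite_subgroupD(2)[OF H(1)] q by (simp add: K_def)
  \<comment> \<open>The largest admissible S'': it accounts for everything in \<open>T\<close> that
    lies in the coset of \<open>s\<close>.\<close>
  define S where "S = {k \<in> K. (s + k) mod int q \<in> T}"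
  have S'_eq: "T - (s <#\<^bsub>?G\<^esub> S) = P"
  proof -
    have "t \<in> s <#\<^bsub>?G\<^esub> S \<longleftrightarrow> ?e t - ?e s \<in> H" if t: "t \<in> T" for t
    proof
      assume "t \<in> s <#\<^bsub>?G\<^esub> S"
      then obtain k where "k \<in> K" "t = (s + k) mod int q" by (auto simp: l_coset_def S_def)
      then show "?e t - ?e s \<in> H" using q by (simp add: embed_add K_def)
    next
      assume *: "?e t - ?e s \<in> H"
      define k where "k = (t - s) mod int q"
      have "k \<in> K" unfolding k_def mod_K embed_diff by (rule *)
      moreover have "(s + k) mod int q = t" using t T q unfolding k_def by (auto simp: mod_add_right_eq)
      ultimately show "t \<in> s <#\<^bsub>?G\<^esub> S" using t by (auto simp: l_coset_def S_def)
    qed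
    then show ?thesis unfolding P_def by blast
  qed
  have "subgroup K ?G"
  proof (rule group.subgroupI[OF group_integer_mod_group])
    show "K \<subseteq> carrier ?G" using q by (auto simp: K_def carrier_integer_mod_group)
    show "K \<noteq> {}" using K0 by blast
    fix a b assume a: "a \<in> K" and b: "b \<in> K"
    then show "a \<otimes>\<^bsub>?G\<^esub> b \<in> K"
      using finite_subgroupD(3)[OF H(1)] by (simp add: mod_K embed_add) (simp add: K_def)
    have "?e (0 - a) \<in> H" unfolding embed_diff embed_0 using a finite_subgroupD(4)[OF H(1)] by (auto simp: K_def)
    then have "(- a) mod int q \<in> K" by (simp add: mod_K)
    then show "inv\<^bsub>?G\<^esub> a \<in> K" using a q by (simp add: K_def carrier_integer_mod_group)
  qed
  moreover have "K \<noteq> {\<one>\<^bsub>?G\<^esub>}"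
  proof -
    obtain h where "h \<in> H" "h \<noteq> 0" using H(1,2) by (auto simp: finite_subgroup_def)
    then show ?thesis using H_K by force
  qed
  moreover have "S \<noteq> {}"
  proof -
    have "0 \<in> S" using K0 s T by (auto simp: S_def)
    then show ?thesis by blast
  qed
  moreover have "S \<subset> K"
  proof -
    obtain h where h: "h \<in> H" "?e s + h \<notin> ?e ` T" using H(4) s(2) by blast
    then obtain k where "k \<in> K" "h = ?e k" using H_K by blast
    then have "k \<in> K - S" using h(2) by (simp add: S_def mod_mem_iff_embed[OF q T] embed_add)
    then show ?thesis by (auto simp: S_def)
  qed
  moreover have "P <#>\<^bsub>?G\<^esub> K = P"
  proof (intro equalityI subsetI)
    fix x assume "x \<in> P <#>\<^bsub>?G\<^esub> K"
    then obtain t k where "t \<in> P" "?e k \<in> H" "x = (t + k) mod int q" by (auto simp: set_mult_def K_def)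
    moreover have "P \<subseteq> {0..<int q}" using T by (auto simp: P_def)
    ultimately show "x \<in> P" using P_H by (simp add: mod_mem_iff_embed[OF q] embed_add)
  next
    fix x assume x: "x \<in> P"
    then have "x = (x + 0) mod int q" using T by (auto simp: P_def)
    then show "x \<in> P <#>\<^bsub>?G\<^esub> K" using x K0 unfolding set_mult_def mult_integer_mod_group by blast
  qed
  moreover have "P \<noteq> {}" using p by blast
  ultimately show ?thesis
    unfolding quasi_periodic_set_def using aper s(1) S'_eq
    by (intro conjI exI[of _ K] exI[of _ s] exI[of _ S] exI[of _ P]) auto
qed

lemma arith_progression_embed:
  assumes q: "q > 0" and T: "T \<subseteq> {0..<int q}" "T \<noteq> {}" and ap: "arith_prog (embed q ` T)"
  shows "arith_progression (integer_mod_group q) T"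
proof -
  let ?G = "integer_mod_group q" and ?e = "embed q"
  obtain a' d' n where eT: "?e ` T = (\<lambda>j. ((+) d' ^^ j) a') ` {..<n}" using ap by (auto simp: arith_prog_def)
  have n: "0 < n" using eT T(2) by (cases n) auto
  then have "((+) d' ^^ 0) a' \<in> ?e ` T" unfolding eT by blast
  then obtain a where a: "a \<in> T" "a' = ?e a" by auto
  \<comment> \<open>A one-term progression does not constrain its difference, which may lie outside
    the image; then 0 is used. With two terms the difference is one of embedded residues.\<close>
  have "\<exists>d\<in>{0..<int q}. \<forall>j<n. ((+) d' ^^ j) a' = ?e (a + int j * d)"
  proof (cases "n = 1")
    case True
    then show ?thesis using a q by (intro bexI[of _ 0]) auto
  next
    case False
    then have "1 \<in> {..<n}" using n by simp
    then have "((+) d' ^^ 1) a' \<in> ?e ` T" unfolding eT by (rule imageI)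
    then obtain b where "d' + a' = ?e b" by auto
    then have "d' = ?e (b - a)" using a by (simp add: embed_diff algebra_simps)
    moreover define d where "d = (b - a) mod int q"
    ultimately have d: "d \<in> {0..<int q}" "d' = ?e d" using q by simp_all
    have "((+) d' ^^ j) a' = ?e (a + int j * d)" for j
      by (induction j) (simp_all add: a d embed_add[symmetric] algebra_simps)
    then show ?thesis using d(1) by blast
  qed
  then obtain d where d: "d \<in> {0..<int q}" "\<And>j. j < n \<Longrightarrow> ((+) d' ^^ j) a' = ?e (a + int j * d)" by blast
  let ?S = "(\<lambda>j. (a + int j * d) mod int q) ` {..<n}"
  have "?e ` ?S = ?e ` T" unfolding eT image_image using d(2) q by (intro image_cong) auto
  moreover have "?S \<subseteq> {0..<int q}" using q by auto
  ultimately have "?S = T" using T(1) by (metis inj_on_embed[OF q] inj_on_image_eq_iff)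
  then have "T = {a \<otimes>\<^bsub>?G\<^esub> (d [^]\<^bsub>?G\<^esub> j) | j. j < n}"
    by (force simp: mod_add_right_eq)
  moreover have "a \<in> carrier ?G" "d \<in> carrier ?G"
    using a T d q by (auto simp: carrier_integer_mod_group)
  ultimately show ?thesis unfolding arith_progression_def by blast
qed

lemma arith_prog_sumset:
  assumes "arith_prog S" "S \<noteq> {}" shows "arith_prog (S + S)"
proof -
  obtain a d n where S: "S = (\<lambda>j. ((+) d ^^ j) a) ` {..<n}" using assms by (auto simp: arith_prog_def)
  have "0 < n" using S assms(2) by (cases n) auto
  have shift: "((+) d ^^ j) (x + y) = ((+) d ^^ j) x + y" for j x y
    by (induction j) (auto simp: add.assoc)
  have add: "((+) d ^^ i) a + ((+) d ^^ j) a = ((+) d ^^ (i + j)) (a + a)" for i j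
  proof -
    have "((+) d ^^ (i + j)) (a + a) = ((+) d ^^ i) (((+) d ^^ j) a + a)"
      by (simp only: funpow_add comp_apply shift)
    then show ?thesis by (metis shift add.commute)
  qed
  have "S + S = (\<lambda>j. ((+) d ^^ j) (a + a)) ` {..<2 * n - 1}"
  proof (intro equalityI subsetI)
    fix x assume "x \<in> S + S"
    then obtain i j where "i < n" "j < n" "x = ((+) d ^^ i) a + ((+) d ^^ j) a"
      by (auto simp: S elim!: set_plus_elim)
    then show "x \<in> (\<lambda>j. ((+) d ^^ j) (a + a)) ` {..<2 * n - 1}"
      using add by (intro image_eqI[of _ _ "i + j"]) auto
  next
    fix x assume "x \<in> (\<lambda>j. ((+) d ^^ j) (a + a)) ` {..<2 * n - 1}"
    then obtain k where k: "k < 2 * n - 1" "x = ((+) d ^^ k) (a + a)" by blast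
    \<comment> \<open>Any k <= 2n - 2 splits into two indices below n; the first is taken as large
      as possible.\<close>
    define i where "i = min k (n - 1)"
    have ik: "i < n" "k - i < n" "i + (k - i) = k" using k(1) \<open>0 < n\<close> by (auto simp: i_def)
    then have "x = ((+) d ^^ i) a + ((+) d ^^ (k - i)) a" using add[of i "k - i"] k(2) by simp
    then show "x \<in> S + S" using ik S by blast
  qed
  then show ?thesis unfolding arith_prog_def by blast
qed

section \<open>Transfer of both group results to residues modulo q\<close>

context
  fixes q :: nat and R :: "int set"
  assumes q: "q > 0" and R: "R \<subseteq> {0..<int q}" "R \<noteq> {}"
    and aper: "\<not> periodic_set (integer_mod_group q) (R <#>\<^bsub>integer_mod_group q\<^esub> R)"
begin

private lemma embed_facts:
  "card (embed q ` R) = card R"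
  "card (embed q ` R + embed q ` R) = card (R <#>\<^bsub>integer_mod_group q\<^esub> R)"
  "\<not> periodic (embed q ` R + embed q ` R)"
proof -
  let ?RR = "R <#>\<^bsub>integer_mod_group q\<^esub> R"
  have ne: "?RR \<noteq> {}" using R(2) by (auto simp: set_mult_def)
  show "card (embed q ` R) = card R" by (rule card_embed_image[OF q R(1)])
  show "card (embed q ` R + embed q ` R) = card ?RR"
    unfolding embed_set_mult[OF q, symmetric] by (rule card_embed_image[OF q set_mult_subset[OF q]])
  show "\<not> periodic (embed q ` R + embed q ` R)"
    unfolding embed_set_mult[OF q, symmetric] using aper periodic_set_embed[OF q set_mult_subset[OF q] ne] by blast
qed

lemma card_set_mult_aperiodic: "2 * card R \<le> card (R <#>\<^bsub>integer_mod_group q\<^esub> R) + 1"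
  using card_sumset_aperiodic[OF finite_subgroup_embed[OF q], of "embed q ` R"] R embed_facts by auto

lemma quasi_periodic_set_or_arith_progression:
  assumes "2 \<le> card R" "card (R <#>\<^bsub>integer_mod_group q\<^esub> R) + 1 \<le> 2 * card R"
  shows "quasi_periodic_set (integer_mod_group q) (R <#>\<^bsub>integer_mod_group q\<^esub> R) \<or>
    arith_progression (integer_mod_group q) (R <#>\<^bsub>integer_mod_group q\<^esub> R) \<and>
    arith_progression (integer_mod_group q) R"
proof -
  let ?RR = "R <#>\<^bsub>integer_mod_group q\<^esub> R"
  have ne: "?RR \<noteq> {}" using R(2) by (auto simp: set_mult_def)
  have "quasi_periodic (embed q ` R + embed q ` R) \<or> arith_prog (embed q ` R)"
    using assms R embed_facts
    by (intro quasi_periodic_sumset_or_arith_prog[OF finite_subgroup_embed[OF q]]) auto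
  then consider "quasi_periodic (embed q ` ?RR)"
    | "arith_prog (embed q ` R)" "arith_prog (embed q ` ?RR)"
    using arith_prog_sumset R(2) unfolding embed_set_mult[OF q] by blast
  then show ?thesis
  proof cases
    case 1
    then show ?thesis using quasi_periodic_set_embed[OF q set_mult_subset[OF q] aper] by blast
  next
    case 2
    have "arith_progression (integer_mod_group q) R"
      by (rule arith_progression_embed[OF q R 2(1)])
    moreover have "arith_progression (integer_mod_group q) ?RR"
      by (rule arith_progression_embed[OF q set_mult_subset[OF q] ne 2(2)])
    ultimately show ?thesis by blast
  qed
qed

end

section \<open>Density of eventually periodic sets\<close>

lemma bij_betw_mod_interval:
  assumes "0 < (m::nat)" shows "bij_betw (\<lambda>x. x mod m) {a..<a + m} {..<m}"
proof -
  have inj: "inj_on (\<lambda>x. x mod m) {a..<a + m}"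
  proof (rule inj_onI)
    fix x y assume xy: "x \<in> {a..<a + m}" "y \<in> {a..<a + m}" "x mod m = y mod m"
    show "x = y"
    proof (rule ccontr)
      assume "x \<noteq> y"
      then have "m \<le> (if x < y then y - x else x - y)"
        using xy(3) mod_eq_dvd_iff_nat[of x y m] mod_eq_dvd_iff_nat[of y x m]
        by (auto intro!: dvd_imp_le split: if_splits)
      then show False using xy by (auto split: if_splits)
    qed
  qed
  have "(\<lambda>x. x mod m) ` {a..<a + m} = {..<m}"
    using assms inj by (intro card_subset_eq) (auto simp: card_image)
  with inj show ?thesis by (simp add: bij_betw_def)
qed

lemma card_mod_interval:
  assumes "0 < (m::nat)" "R \<subseteq> {..<m}"
  shows "card {x \<in> {a..<a + m}. x mod m \<in> R} = card R"
proof -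
  note bij = bij_betw_mod_interval[OF assms(1), of a]
  have "(\<lambda>x. x mod m) ` {x \<in> {a..<a + m}. x mod m \<in> R} = (\<lambda>x. x mod m) ` {a..<a + m} \<inter> R"
    by blast
  also have "\<dots> = R" using bij_betw_imp_surj_on[OF bij] assms(2) by (simp add: Int_absorb1)
  finally have "bij_betw (\<lambda>x. x mod m) {x \<in> {a..<a + m}. x mod m \<in> R} R"
    by (intro bij_betw_subset[OF bij]) auto
  then show ?thesis by (rule bij_betw_same_card)
qed

lemma card_mod_multiple:
  assumes "0 < (m::nat)" "R \<subseteq> {..<m}"
  shows "card {x \<in> {..<k * m}. x mod m \<in> R} = k * card R"
proof (induction k)
  case (Suc k)
  let ?A = "{x \<in> {..<k * m}. x mod m \<in> R}" and ?B = "{x \<in> {k * m..<k * m + m}. x mod m \<in> R}"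
  have "{..<Suc k * m} = {..<k * m} \<union> {k * m..<k * m + m}"
    by (simp add: ivl_disj_un_one(2) add.commute)
  then have "{x \<in> {..<Suc k * m}. x mod m \<in> R} = ?A \<union> ?B" by (simp only:) blast
  moreover have "{..<k * m} \<inter> {k * m..<k * m + m} = {}" by (rule ivl_disj_int_one(2))
  then have "?A \<inter> ?B = {}" by blast
  then have "card (?A \<union> ?B) = card ?A + card ?B" by (intro card_Un_disjoint) simp_all
  ultimately have "card {x \<in> {..<Suc k * m}. x mod m \<in> R} = card ?A + card ?B" by metis
  then show ?case using Suc card_mod_interval[OF assms] by simp
qed simp

text \<open>Differences 0 are allowed in \<open>buck_family\<close>, so residues decide membership
  only from some point on; finite sets have R = {}.\<close>

definition eventually_residues :: "nat set \<Rightarrow> nat \<Rightarrow> nat set \<Rightarrow> bool" where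
  "eventually_residues A m R \<longleftrightarrow> 0 < m \<and> R \<subseteq> {..<m} \<and> (\<exists>N. \<forall>x\<ge>N. x \<in> A \<longleftrightarrow> x mod m \<in> R)"

text \<open>The deviation \<open>h\<close> from the expected count is \<open>m\<close>-periodic
  beyond \<open>N\<close>, hence bounded, and vanishes in the limit after division by n.\<close>

lemma natural_density_eventually_residues:
  assumes "eventually_residues A m R"
  shows "natural_density A = real (card R) / real m"
proof -
  obtain N where m: "0 < m" and R: "R \<subseteq> {..<m}" and N: "\<And>x. N \<le> x \<Longrightarrow> x \<in> A \<longleftrightarrow> x mod m \<in> R"
    using assms by (auto simp: eventually_residues_def)
  define h where "h = (\<lambda>n. real (card (A \<inter> {1..n})) - real n * real (card R) / real m)"
  have step: "h (n + m) = h n" if "N \<le> n" for n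
  proof -
    let ?B = "{x \<in> {n + 1..<n + 1 + m}. x mod m \<in> R}"
    have "x \<in> A \<inter> {1..n + m} \<longleftrightarrow> x \<in> A \<inter> {1..n} \<union> ?B" for x
      using N[of x] that by (cases "x \<le> n") auto
    then have "A \<inter> {1..n + m} = (A \<inter> {1..n}) \<union> ?B" by blast
    moreover have "(A \<inter> {1..n}) \<inter> ?B = {}" by fastforce
    then have "card ((A \<inter> {1..n}) \<union> ?B) = card (A \<inter> {1..n}) + card ?B"
      by (intro card_Un_disjoint) simp_all
    ultimately have "card (A \<inter> {1..n + m}) = card (A \<inter> {1..n}) + card R"
      by (simp only: card_mod_interval[OF m R])
    then show ?thesis using m by (simp add: h_def field_simps)
  qed
  define M where "M = Max ((\<lambda>n. \<bar>h n\<bar>) ` {..<N + m})"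
  have bound: "\<bar>h n\<bar> \<le> M" for n
  proof (induction n rule: less_induct)
    case (less n)
    show ?case
    proof (cases "n < N + m")
      case True
      then show ?thesis unfolding M_def by (intro Max_ge) auto
    next
      case False
      then have "h n = h (n - m)" using step[of "n - m"] by simp
      then show ?thesis using less[of "n - m"] False m by simp
    qed
  qed
  have "(\<lambda>n. M / real n) \<longlonglongrightarrow> 0" by (rule lim_const_over_n)
  then have "(\<lambda>n. h n / real n) \<longlonglongrightarrow> 0"
  proof (rule tendsto_0_le[where K = 1])
    have "norm (h n / real n) \<le> norm (M / real n) * 1" for n
      using bound[of n] by (auto intro!: divide_right_mono)
    then show "\<forall>\<^sub>F n in sequentially. norm (h n / real n) \<le> norm (M / real n) * 1" by simp
  qed
  from tendsto_add[OF this tendsto_const[of "real (card R) / real m"]]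
  have "(\<lambda>n. h n / real n + real (card R) / real m) \<longlonglongrightarrow> real (card R) / real m" by simp
  moreover have "\<forall>\<^sub>F n in sequentially. h n / real n + real (card R) / real m = real (card (A \<inter> {1..n})) / real n"
    by (rule eventually_sequentiallyI[of 1]) (simp add: h_def diff_divide_distrib)
  ultimately have "(\<lambda>n. real (card (A \<inter> {1..n})) / real n) \<longlonglongrightarrow> real (card R) / real m"
    by (rule Lim_transform_eventually)
  then show ?thesis unfolding natural_density_def by (rule limI)
qed


section \<open>Upper Buck density through residues\<close>

definition nat_residues :: "nat \<Rightarrow> nat set \<Rightarrow> nat set" where
  "nat_residues m Y = (\<lambda>y. y mod m) ` Y"

lemma nat_residues_subset: "0 < m \<Longrightarrow> nat_residues m Y \<subseteq> {..<m}"
  by (auto simp: nat_residues_def)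

lemma progression_eq: "progression a k = {x. a \<le> x \<and> x mod k = a mod k}" if "k > 0"
proof (intro equalityI subsetI CollectI)
  fix x assume "x \<in> progression a k"
  then show "a \<le> x \<and> x mod k = a mod k" by (auto simp: progression_def)
next
  fix x assume "x \<in> {x. a \<le> x \<and> x mod k = a mod k}"
  then have x: "a \<le> x" "x mod k = a mod k" by auto
  then have "k dvd x - a" by (simp add: mod_eq_dvd_iff_nat)
  then obtain n where "x - a = k * n" by blast
  then have "x = a + k * n" using x(1) by simp
  then show "x \<in> progression a k" by (auto simp: progression_def)
qed

lemma progression_0: "progression a 0 = {a}"
  by (auto simp: progression_def)

lemma eventually_residues_progression: "\<exists>m R. eventually_residues (progression a k) m R"
proof (cases "k = 0")
  case True
  then have "eventually_residues (progression a k) 1 {}"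
    unfolding eventually_residues_def by (auto simp: progression_0 intro!: exI[of _ "Suc a"])
  then show ?thesis by blast
next
  case False
  then have "eventually_residues (progression a k) k {a mod k}"
    unfolding eventually_residues_def by (auto simp: progression_eq intro!: exI[of _ a])
  then show ?thesis by blast
qed

lemma eventually_residues_Un:
  assumes "eventually_residues A m R" "eventually_residues B n S"
  shows "eventually_residues (A \<union> B) (m * n) {x \<in> {..<m * n}. x mod m \<in> R \<or> x mod n \<in> S}"
proof -
  obtain M N where "\<And>x. M \<le> x \<Longrightarrow> x \<in> A \<longleftrightarrow> x mod m \<in> R" "\<And>x. N \<le> x \<Longrightarrow> x \<in> B \<longleftrightarrow> x mod n \<in> S"
    using assms by (auto simp: eventually_residues_def)
  moreover have "x mod (m * n) mod m = x mod m" "x mod (m * n) mod n = x mod n" for x :: nat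
    by (simp_all add: mod_mod_cancel)
  moreover have pos: "0 < m * n" using assms by (simp add: eventually_residues_def)
  ultimately have "x \<in> A \<union> B \<longleftrightarrow> x mod (m * n) \<in> {x \<in> {..<m * n}. x mod m \<in> R \<or> x mod n \<in> S}"
    if "max M N \<le> x" for x
    using that by simp
  then show ?thesis using pos unfolding eventually_residues_def by blast
qed

lemma eventually_residues_buck_family:
  assumes "A \<in> buck_family" obtains m R where "eventually_residues A m R"
proof -
  obtain r :: nat and a k where A: "A = (\<Union>i\<in>{1..r}. progression (a i) (k i))"
    using assms by (auto simp: buck_family_def)
  have "\<exists>m R. eventually_residues (\<Union>i\<in>{1..r}. progression (a i) (k i)) m R"
  proof (induction r)
    case 0
    have "eventually_residues {} 1 {}" by (simp add: eventually_residues_def)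
    then show ?case by (intro exI[of _ 1] exI[of _ "{}"]) simp
  next
    case (Suc r)
    have "(\<Union>i\<in>{1..Suc r}. progression (a i) (k i)) =
        (\<Union>i\<in>{1..r}. progression (a i) (k i)) \<union> progression (a (Suc r)) (k (Suc r))"
      by (simp add: atLeastAtMostSuc_conv Un_commute)
    moreover obtain m R where "eventually_residues (\<Union>i\<in>{1..r}. progression (a i) (k i)) m R"
      using Suc by blast
    moreover obtain n S where "eventually_residues (progression (a (Suc r)) (k (Suc r))) n S"
      using eventually_residues_progression by blast
    ultimately show ?case by (simp only:) (blast intro: eventually_residues_Un)
  qed
  then show thesis using that A by blast
qed

lemma buck_familyI:
  assumes "finite I" shows "(\<Union>(a, k)\<in>I. progression a k) \<in> buck_family"
proof -
  obtain f where "bij_betw f {1..card I} I" using ex_bij_betw_nat_finite_1[OF assms] by blast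
  then have fI: "f ` {1..card I} = I" by (simp add: bij_betw_def)
  have "(\<Union>p\<in>f ` {1..card I}. progression (fst p) (snd p)) =
      (\<Union>i\<in>{1..card I}. progression (fst (f i)) (snd (f i)))"
    by (simp only: image_image)
  then have "(\<Union>p\<in>I. progression (fst p) (snd p)) =
      (\<Union>i\<in>{1..card I}. progression (fst (f i)) (snd (f i)))" unfolding fI .
  then show ?thesis unfolding buck_family_def case_prod_unfold
    by (intro CollectI exI[of _ "card I"] exI[of _ "\<lambda>i. fst (f i)"] exI[of _ "\<lambda>i. snd (f i)"])
qed

text \<open>Elements of \<open>Y\<close> beyond the threshold occupy only lifts of the classes in
  \<open>R\<close>; those below it add a number of classes that does not grow with k.\<close>

lemma card_nat_residues_le:
  assumes "eventually_residues A m R" "Y \<subseteq> A"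
  obtains N where "\<And>k. card (nat_residues (k * m) Y) \<le> k * card R + N"
proof -
  obtain N where m: "0 < m" and R: "R \<subseteq> {..<m}" and N: "\<And>x. N \<le> x \<Longrightarrow> x \<in> A \<longleftrightarrow> x mod m \<in> R"
    using assms by (auto simp: eventually_residues_def)
  have "card (nat_residues (k * m) Y) \<le> k * card R + N" if "k > 0" for k
  proof -
    have "nat_residues (k * m) Y \<subseteq> {x \<in> {..<k * m}. x mod m \<in> R} \<union> (\<lambda>x. x mod (k * m)) ` {..<N}"
    proof
      fix z assume "z \<in> nat_residues (k * m) Y"
      then obtain y where y: "y \<in> Y" "z = y mod (k * m)" by (auto simp: nat_residues_def)
      show "z \<in> {x \<in> {..<k * m}. x mod m \<in> R} \<union> (\<lambda>x. x mod (k * m)) ` {..<N}"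
      proof (cases "y < N")
        case False
        then have "z mod m \<in> R" using y N[of y] assms(2) by (auto simp: mod_mod_cancel)
        then show ?thesis using y(2) m that by simp
      qed (use y(2) in blast)
    qed
    then have "card (nat_residues (k * m) Y) \<le>
        card ({x \<in> {..<k * m}. x mod m \<in> R} \<union> (\<lambda>x. x mod (k * m)) ` {..<N})"
      by (intro card_mono) auto
    also have "\<dots> \<le> k * card R + card ((\<lambda>x. x mod (k * m)) ` {..<N})"
      using card_Un_le card_mod_multiple[OF m R] by metis
    also have "\<dots> \<le> k * card R + N" using card_image_le[of "{..<N}" "\<lambda>x. x mod (k * m)"] by simp
    finally show ?thesis .
  qed
  \<comment> \<open>For k = 0 reduction is the identity; adding the cardinality for modulus 0 makes
    the bound uniform in \<open>k\<close>.\<close>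
  then have "card (nat_residues (k * m) Y) \<le> k * card R + N + card (nat_residues 0 Y)" for k
    by (cases "k = 0") (auto intro: trans_le_add1)
  then show thesis using that[of "N + card (nat_residues 0 Y)"] by (simp add: add.assoc)
qed

lemma natural_density_nonneg:
  assumes "A \<in> buck_family" shows "0 \<le> natural_density A"
  using eventually_residues_buck_family[OF assms] natural_density_eventually_residues
  by (metis divide_nonneg_nonneg of_nat_0_le_iff)

text \<open>The exceptional set \<open>F\<close> is covered by progressions of difference 0, which
  contribute no density. This freedom is what later yields infinite intersections.\<close>

lemma upper_buck_density_le:
  assumes m: "0 < m" and F: "finite F"
  shows "upper_buck_density Y \<le> real (card (nat_residues m (Y - F))) / real m"
proof -
  let ?R = "nat_residues m (Y - F)"
  have finR: "finite ?R" using nat_residues_subset[OF m] finite_subset by blast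
  define I where "I = (\<lambda>a. (a, m)) ` ?R \<union> (\<lambda>a. (a, 0)) ` F"
  define A where "A = (\<Union>(a, k)\<in>I. progression a k)"
  have "finite I" using finR F by (simp add: I_def)
  then have fam: "A \<in> buck_family" unfolding A_def by (rule buck_familyI)
  have A_eq: "A = (\<Union>a\<in>?R. progression a m) \<union> F"
    unfolding A_def I_def by (auto simp: progression_0)
  have R_iff: "x \<in> (\<Union>a\<in>?R. progression a m) \<longleftrightarrow> x mod m \<in> ?R" for x
  proof
    assume "x \<in> (\<Union>a\<in>?R. progression a m)"
    then show "x mod m \<in> ?R" using progression_eq[OF m] nat_residues_subset[OF m, of "Y - F"] by fastforce
  next
    assume "x mod m \<in> ?R"
    then show "x \<in> (\<Union>a\<in>?R. progression a m)" using progression_eq[OF m] by (intro UN_I[of "x mod m"]) auto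
  qed
  have "Y \<subseteq> A" unfolding A_eq using R_iff by (auto simp: nat_residues_def)
  moreover have "eventually_residues A m ?R" unfolding eventually_residues_def
  proof (intro conjI exI allI impI)
    fix x assume x: "Suc (Max (insert 0 F)) \<le> x"
    have "x \<notin> F"
    proof
      assume "x \<in> F"
      then have "x \<le> Max (insert 0 F)" using F by (intro Max_ge) auto
      then show False using x by simp
    qed
    then show "x \<in> A \<longleftrightarrow> x mod m \<in> ?R" unfolding A_eq using R_iff by blast
  qed (use m nat_residues_subset[OF m] in auto)
  then have "natural_density A = real (card ?R) / real m" by (rule natural_density_eventually_residues)
  moreover have "bdd_below (natural_density ` {A \<in> buck_family. Y \<subseteq> A})"
    using natural_density_nonneg by (intro bdd_belowI2[of _ 0]) blast
  then have "Inf (natural_density ` {A \<in> buck_family. Y \<subseteq> A}) \<le> natural_density A"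
    using fam \<open>Y \<subseteq> A\<close> by (intro cInf_lower) blast+
  ultimately show ?thesis unfolding upper_buck_density_def by simp
qed

text \<open>A covering set of small density may have initial terms outside its residue pattern.
  Modulo a large multiple \<open>k * m\<close> these add a bounded number of classes, a negligible
  proportion.\<close>

lemma ex_modulus_less:
  assumes "upper_buck_density Y < c"
  obtains m where "0 < m" "real (card (nat_residues m Y)) / real m < c"
proof -
  have "UNIV = (\<Union>(a, k)\<in>{(0, 1)}. progression a k)" by (auto simp: progression_eq)
  then have "UNIV \<in> buck_family" using buck_familyI[of "{(0, 1)}"] by simp
  then have "natural_density ` {A \<in> buck_family. Y \<subseteq> A} \<noteq> {}" by blast
  from cInf_lessD[OF this assms[unfolded upper_buck_density_def]]
  obtain A where A: "A \<in> buck_family" "Y \<subseteq> A" "natural_density A < c" by auto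
  obtain m R where er: "eventually_residues A m R" using eventually_residues_buck_family[OF A(1)] .
  obtain N where N: "\<And>k. card (nat_residues (k * m) Y) \<le> k * card R + N"
    using card_nat_residues_le[OF er A(2)] by metis
  have m: "0 < m" using er by (simp add: eventually_residues_def)
  have d: "natural_density A = real (card R) / real m" by (rule natural_density_eventually_residues[OF er])
  \<comment> \<open>The excess N / (k m) has to stay below the slack between \<open>c\<close> and
    the density of \<open>A\<close>; since m >= 1, it suffices that N / k does.\<close>
  obtain k :: nat where k: "real N / (c - natural_density A) < real k" using reals_Archimedean2 by blast
  have pos: "0 < c - natural_density A" using A(3) by simp
  then have "0 \<le> real N / (c - natural_density A)" by simp
  then have k0: "0 < k" using k by (metis gr0I leD of_nat_0)
  have Nk: "real N < real k * (c - natural_density A)" using k pos by (simp add: pos_divide_less_eq)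
  have "real (card (nat_residues (k * m) Y)) \<le> real k * real (card R) + real N"
    using N[of k] by (metis of_nat_add of_nat_le_iff of_nat_mult)
  also have "\<dots> = real k * real m * natural_density A + real N" using m by (simp add: d)
  also have "\<dots> \<le> real k * real m * natural_density A + real m * real N"
    using m by (simp add: mult_le_cancel_right1)
  also have "\<dots> < real k * real m * natural_density A + real m * (real k * (c - natural_density A))"
    using Nk m by simp
  also have "\<dots> = c * real (k * m)" by (simp add: algebra_simps)
  finally have "real (card (nat_residues (k * m) Y)) / real (k * m) < c"
    using k0 m by (simp add: pos_divide_less_eq)
  then show thesis using that[of "k * m"] k0 m by simp
qed

lemma residues_mod_eq: "residues_mod m Y = int ` nat_residues m Y"
  by (auto simp: residues_mod_def proj_mod_def nat_residues_def zmod_int image_image)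

lemma card_residues_mod: "card (residues_mod m Y) = card (nat_residues m Y)"
  unfolding residues_mod_eq by (rule card_image) simp

lemma residues_mod_subset: "0 < m \<Longrightarrow> residues_mod m Y \<subseteq> {0..<int m}"
  using nat_residues_subset[of m Y] by (auto simp: residues_mod_eq)

lemma residues_mod_sumset:
  assumes "0 < m"
  shows "residues_mod m (X + Y) = residues_mod m X <#>\<^bsub>integer_mod_group m\<^esub> residues_mod m Y"
proof (intro equalityI subsetI)
  fix z assume "z \<in> residues_mod m (X + Y)"
  then obtain w where "w \<in> X + Y" "z = int w mod int m" by (auto simp: residues_mod_def proj_mod_def)
  then obtain x y where "x \<in> X" "y \<in> Y" "z = (int x mod int m + int y mod int m) mod int m"
    by (metis set_plus_elim mod_add_eq of_nat_add)
  then show "z \<in> residues_mod m X <#>\<^bsub>integer_mod_group m\<^esub> residues_mod m Y"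
    by (auto simp: residues_mod_def proj_mod_def set_mult_def)
next
  fix z assume "z \<in> residues_mod m X <#>\<^bsub>integer_mod_group m\<^esub> residues_mod m Y"
  then obtain x y where xy: "x \<in> X" "y \<in> Y" "z = (int x mod int m + int y mod int m) mod int m"
    by (auto simp: residues_mod_def proj_mod_def set_mult_def)
  then have "z = proj_mod m (int (x + y))" by (simp add: proj_mod_def mod_add_eq)
  then show "z \<in> residues_mod m (X + Y)" using xy(1,2) unfolding residues_mod_def by blast
qed

section \<open>Periods of residue sets\<close>

definition period :: "nat \<Rightarrow> nat set \<Rightarrow> nat \<Rightarrow> bool" where
  "period m Y g \<longleftrightarrow> (\<forall>z. z mod m \<in> nat_residues m Y \<longrightarrow> (z + g) mod m \<in> nat_residues m Y)"

lemma period_mod_eq: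
  assumes "period m Y g" "g mod m = h mod m" shows "period m Y h"
  using assms unfolding period_def by (metis mod_add_right_eq)

lemma period_add: "period m Y g \<Longrightarrow> period m Y h \<Longrightarrow> period m Y (g + h)"
  by (simp add: period_def add.assoc[symmetric])

lemma period_mult: "period m Y g \<Longrightarrow> period m Y (k * g)"
  by (induction k) (simp_all add: period_add, simp add: period_def)

lemma periodic_set_residues_mod_iff:
  assumes m: "0 < m"
  shows "periodic_set (integer_mod_group m) (residues_mod m Y) \<longleftrightarrow> (\<exists>g. 0 < g \<and> g < m \<and> period m Y g)"
proof
  assume "periodic_set (integer_mod_group m) (residues_mod m Y)"
  then obtain g where g: "g \<in> {0..<int m}" "g \<noteq> 0"
    and sub: "(\<Union>x\<in>residues_mod m Y. {(x + g) mod int m}) \<subseteq> residues_mod m Y"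
    using m by (auto simp: periodic_set_def r_coset_def carrier_integer_mod_group)
  define h where "h = nat g"
  have h: "g = int h" "0 < h" "h < m" using g by (auto simp: h_def)
  have "period m Y h" unfolding period_def
  proof (intro allI impI)
    fix z assume "z mod m \<in> nat_residues m Y"
    then have "(int (z mod m) + g) mod int m \<in> residues_mod m Y"
      using sub unfolding residues_mod_eq by blast
    then have "int ((z + h) mod m) \<in> int ` nat_residues m Y"
      by (simp add: h(1) residues_mod_eq zmod_int mod_add_left_eq)
    then show "(z + h) mod m \<in> nat_residues m Y" by (simp add: inj_image_mem_iff)
  qed
  with h show "\<exists>g. 0 < g \<and> g < m \<and> period m Y g" by blast
next
  assume "\<exists>g. 0 < g \<and> g < m \<and> period m Y g"
  then obtain g where g: "0 < g" "g < m" "period m Y g" by blast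
  have "(x + int g) mod int m \<in> residues_mod m Y" if "x \<in> residues_mod m Y" for x
  proof -
    obtain z where z: "z \<in> nat_residues m Y" "x = int z"
      using \<open>x \<in> residues_mod m Y\<close> by (auto simp: residues_mod_eq)
    then have "z mod m \<in> nat_residues m Y" by (auto simp: nat_residues_def)
    then have "(z + g) mod m \<in> nat_residues m Y" using g(3) by (simp add: period_def)
    moreover have "(x + int g) mod int m = int ((z + g) mod m)" by (simp add: z(2) zmod_int)
    ultimately show ?thesis unfolding residues_mod_eq by blast
  qed
  then show "periodic_set (integer_mod_group m) (residues_mod m Y)"
    unfolding periodic_set_def using m g
    by (intro bexI[of _ "int g"]) (auto simp: r_coset_def carrier_integer_mod_group)
qed

text \<open>Residues modulo a divisor are the image of the residues modulo \<open>m\<close>, so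
  periods descend.\<close>

lemma period_dvd_modulus:
  assumes "q dvd m" "period m Y g" shows "period q Y g"
  unfolding period_def
proof (intro allI impI)
  fix z assume "z mod q \<in> nat_residues q Y"
  then obtain y where y: "y \<in> Y" "z mod q = y mod q" by (auto simp: nat_residues_def)
  then have "(y + g) mod m \<in> nat_residues m Y" using assms(2) by (simp add: period_def nat_residues_def)
  then obtain y' where y': "y' \<in> Y" "(y + g) mod m = y' mod m" by (auto simp: nat_residues_def)
  have "(z + g) mod q = (y + g) mod q" using y(2) by (metis mod_add_left_eq)
  also have "\<dots> = y' mod q" using y'(2) assms(1) by (metis mod_mod_cancel)
  finally show "(z + g) mod q \<in> nat_residues q Y" using y'(1) by (simp add: nat_residues_def)
qed

lemma aperiodic_dvd_period:
  assumes "0 < q" "\<not> periodic_set (integer_mod_group q) (residues_mod q Y)" "period q Y g"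
  shows "q dvd g"
proof -
  have "period q Y (g mod q)" using period_mod_eq[OF assms(3)] by simp
  moreover have "g mod q < q" using assms(1) by simp
  ultimately have "g mod q = 0" using assms(2) unfolding periodic_set_residues_mod_iff[OF assms(1)] by (metis gr0I)
  then show ?thesis by (rule mod_0_imp_dvd)
qed

text \<open>\<open>Q\<close> is the least positive period modulo \<open>m\<close>. The residues
  modulo \<open>m\<close> are then the full preimage of those modulo \<open>Q\<close>: this
  preserves the quotient of residue count by modulus, and a smaller period modulo \<open>Q\<close>
  would lift to one modulo \<open>m\<close>.\<close>

lemma ex_aperiodic_modulus:
  assumes m: "0 < m"
  obtains Q where "0 < Q" "Q dvd m" "period m Y Q"
    "\<not> periodic_set (integer_mod_group Q) (residues_mod Q Y)"
    "card (nat_residues m Y) * Q = card (nat_residues Q Y) * m"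
proof -
  have pm: "0 < m \<and> period m Y m" using m by (simp add: period_def)
  define Q where "Q = (LEAST g. 0 < g \<and> period m Y g)"
  have Q: "0 < Q" "period m Y Q" using LeastI[of "\<lambda>g. 0 < g \<and> period m Y g", OF pm] by (simp_all add: Q_def)
  have min: "Q \<le> g" if "0 < g" "period m Y g" for g
    unfolding Q_def using that by (intro Least_le) blast
  have "Q dvd m"
  proof -
    \<comment> \<open>The identity m mod Q = m - (m div Q) Q made free of subtraction: a multiple of
      \<open>m\<close> is added so that the right-hand side is a sum of periods.\<close>
    have "m mod Q + (m div Q) * Q * m = m + (m div Q * (m - 1)) * Q"
      using m mod_mult_div_eq[of m Q] by (cases m) (simp_all add: algebra_simps)
    moreover have "period m Y (m + (m div Q * (m - 1)) * Q)" using pm Q(2) by (intro period_add period_mult) auto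
    ultimately have "period m Y (m mod Q)" by (metis period_mod_eq mod_mult_self1)
    then have "m mod Q = 0" using min[of "m mod Q"] Q(1) by (metis gr0I leD mod_less_divisor)
    then show ?thesis by blast
  qed
  then obtain k where k: "m = k * Q" by (metis dvd_def mult.commute)
  have lift: "w mod m \<in> nat_residues m Y" if y: "y \<in> Y" "w mod Q = y mod Q" for w y
  proof -
    \<comment> \<open>Adding \<open>y * m\<close> leaves the class modulo \<open>m\<close> unchanged
      and lifts w to at least y, so that y can be subtracted.\<close>
    have "y * 1 \<le> y * m" using m by (intro mult_le_mono2) simp
    then have le: "y \<le> w + y * m" by linarith
    have "(w + y * m) mod Q = y mod Q" using \<open>Q dvd m\<close> y(2) by (metis dvd_mult mod_add_right_eq dvd_imp_mod_0 add.right_neutral)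
    then have "Q dvd (w + y * m) - y" using le by (simp add: mod_eq_dvd_iff_nat)
    then obtain j where "(w + y * m) - y = j * Q" by (metis dvd_def mult.commute)
    then have "w + y * m = y + j * Q" using le by simp
    moreover have "(y + j * Q) mod m \<in> nat_residues m Y"
      using period_mult[OF Q(2), of j] y(1) by (simp add: period_def nat_residues_def)
    ultimately show ?thesis by (metis mod_mult_self1)
  qed
  have res_iff: "w mod m \<in> nat_residues m Y \<longleftrightarrow> w mod Q \<in> nat_residues Q Y" for w
  proof
    assume "w mod m \<in> nat_residues m Y"
    then obtain y where "y \<in> Y" "w mod m = y mod m" by (auto simp: nat_residues_def)
    then show "w mod Q \<in> nat_residues Q Y" using \<open>Q dvd m\<close> unfolding nat_residues_def
      by (metis imageI mod_mod_cancel)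
  next
    assume "w mod Q \<in> nat_residues Q Y"
    then show "w mod m \<in> nat_residues m Y" using lift by (auto simp: nat_residues_def)
  qed
  have "\<not> periodic_set (integer_mod_group Q) (residues_mod Q Y)"
  proof
    assume "periodic_set (integer_mod_group Q) (residues_mod Q Y)"
    then obtain g where g: "0 < g" "g < Q" "period Q Y g" using periodic_set_residues_mod_iff[OF Q(1)] by blast
    then have "period m Y g" unfolding period_def res_iff by simp
    then show False using min g by (metis leD)
  qed
  moreover have "card (nat_residues m Y) * Q = card (nat_residues Q Y) * m"
  proof -
    have "nat_residues m Y = {x \<in> {..<k * Q}. x mod Q \<in> nat_residues Q Y}"
    proof (intro equalityI subsetI)
      fix x assume x: "x \<in> nat_residues m Y"
      then have "x < m" using nat_residues_subset[OF m, of Y] by blast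
      then show "x \<in> {x \<in> {..<k * Q}. x mod Q \<in> nat_residues Q Y}"
        using res_iff[of x] x by (simp add: k)
    next
      fix x assume "x \<in> {x \<in> {..<k * Q}. x mod Q \<in> nat_residues Q Y}"
      then show "x \<in> nat_residues m Y" using res_iff[of x] by (simp add: k)
    qed
    then have "card (nat_residues m Y) = k * card (nat_residues Q Y)"
      using card_mod_multiple[OF Q(1) nat_residues_subset[OF Q(1)]] by simp
    then show ?thesis by (simp add: k)
  qed
  ultimately show thesis using that Q \<open>Q dvd m\<close> by blast
qed

lemma card_nat_residues_mult:
  assumes "0 < m" "0 < k" shows "card (nat_residues (k * m) Y) \<le> k * card (nat_residues m Y)"
proof -
  have "nat_residues (k * m) Y \<subseteq> {x \<in> {..<k * m}. x mod m \<in> nat_residues m Y}"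
    using assms by (auto simp: nat_residues_def mod_mod_cancel)
  then have "card (nat_residues (k * m) Y) \<le> card {x \<in> {..<k * m}. x mod m \<in> nat_residues m Y}"
    by (intro card_mono) auto
  then show ?thesis using card_mod_multiple[OF assms(1) nat_residues_subset[OF assms(1)]] by simp
qed

section \<open>Critical moduli and the density of X + X\<close>

text \<open>The upper bound |X mod Q| / Q for the density of X turns the hypothesis into |(X + X)
  mod Q| < 2|X mod Q|, and Kneser's bound leaves exactly one value. It serves both to find
  \<open>q\<close> and to examine a competing modulus.\<close>

lemma ex_critical_modulus:
  assumes m: "0 < m" and less: "real (card (nat_residues m (X + X))) / real m < 2 * upper_buck_density X"
  obtains Q where "0 < Q" "period m (X + X) Q"
    "\<not> periodic_set (integer_mod_group Q) (residues_mod Q (X + X))"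
    "real (card (nat_residues Q (X + X))) / real Q = real (card (nat_residues m (X + X))) / real m"
    "card (nat_residues Q (X + X)) + 1 = 2 * card (nat_residues Q X)"
proof -
  obtain Q where Q: "0 < Q" "Q dvd m" "period m (X + X) Q"
    "\<not> periodic_set (integer_mod_group Q) (residues_mod Q (X + X))"
    "card (nat_residues m (X + X)) * Q = card (nat_residues Q (X + X)) * m"
    using ex_aperiodic_modulus[OF m] .
  have eq: "real (card (nat_residues Q (X + X))) / real Q = real (card (nat_residues m (X + X))) / real m"
    using Q(1,5) m by (simp add: field_simps flip: of_nat_mult)
  have "upper_buck_density X \<le> real (card (nat_residues Q X)) / real Q"
    using upper_buck_density_le[OF Q(1), of "{}" X] by simp
  then have "real (card (nat_residues Q (X + X))) / real Q < 2 * (real (card (nat_residues Q X)) / real Q)"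
    using less eq by linarith
  then have lt: "card (nat_residues Q (X + X)) < 2 * card (nat_residues Q X)"
    using Q(1) by (simp add: divide_less_cancel)
  then have "residues_mod Q X \<noteq> {}" by (auto simp: residues_mod_eq)
  then have "2 * card (residues_mod Q X) \<le> card (residues_mod Q (X + X)) + 1"
    using card_set_mult_aperiodic[OF Q(1) residues_mod_subset[OF Q(1)], of X] Q(4)
    by (simp add: residues_mod_sumset[OF Q(1)])
  then have "card (nat_residues Q (X + X)) + 1 = 2 * card (nat_residues Q X)"
    using lt by (simp add: card_residues_mod)
  with that Q(1,3,4) eq show thesis by blast
qed

lemma upper_buck_density_sumset:
  assumes q: "0 < q" and aper: "\<not> periodic_set (integer_mod_group q) (residues_mod q (X + X))"
    and less: "real (card (nat_residues q (X + X))) / real q < 2 * upper_buck_density X"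
  shows "upper_buck_density (X + X) = real (card (nat_residues q (X + X))) / real q"
proof (rule antisym)
  show "upper_buck_density (X + X) \<le> real (card (nat_residues q (X + X))) / real q"
    using upper_buck_density_le[OF q, of "{}" "X + X"] by simp
  show "real (card (nat_residues q (X + X))) / real q \<le> upper_buck_density (X + X)"
  proof (rule ccontr)
    let ?c = "\<lambda>m. card (nat_residues m (X + X))"
    assume "\<not> ?thesis"
    then obtain M where M: "0 < M" "real (?c M) / real M < real (?c q) / real q"
      using ex_modulus_less[of "X + X" "real (?c q) / real q"] by (metis not_le)
    \<comment> \<open>Passing to the multiple \<open>q * M\<close> does not raise the quotient of
      \<open>M\<close>, and it makes \<open>q\<close> a divisor of the modulus, so that periods can
      descend to \<open>q\<close>.\<close>
    have "real (?c (q * M)) \<le> real q * real (?c M)"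
      using card_nat_residues_mult[OF M(1) q, of "X + X"] by (metis of_nat_le_iff of_nat_mult)
    then have "real (?c (q * M)) / real (q * M) \<le> real (?c M) / real M"
      using q M(1) by (simp add: field_simps)
    then have small: "real (?c (q * M)) / real (q * M) < real (?c q) / real q" using M(2) by linarith
    have "0 < q * M" using q M(1) by simp
    moreover have "real (?c (q * M)) / real (q * M) < 2 * upper_buck_density X" using small less by linarith
    ultimately obtain Q where Q: "0 < Q" "period (q * M) (X + X) Q"
      "real (?c Q) / real Q = real (?c (q * M)) / real (q * M)"
      "?c Q + 1 = 2 * card (nat_residues Q X)"
      using ex_critical_modulus by metis
    \<comment> \<open>\<open>Q\<close> is also a period modulo \<open>q\<close>, where only
      multiples of \<open>q\<close> are periods.\<close>
    have "q dvd Q"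
      using aperiodic_dvd_period[OF q aper] period_dvd_modulus[OF _ Q(2), of q] by simp
    then obtain k where k: "Q = k * q" by (metis dvd_def mult.commute)
    have "real (?c Q) / real Q < real (?c q) / real q" using Q(3) small by simp
    then have "real (?c Q) < real k * real (?c q)" using Q(1) q by (simp add: k field_simps)
    then have 1: "?c Q < k * ?c q" by (metis of_nat_less_iff of_nat_mult)
    have "upper_buck_density X \<le> real (card (nat_residues Q X)) / real Q"
      using upper_buck_density_le[OF Q(1), of "{}" X] by simp
    then have "real (?c q) / real q < 2 * (real (card (nat_residues Q X)) / real Q)" using less by linarith
    then have "real k * real (?c q) < 2 * real (card (nat_residues Q X))"
      using Q(1) q by (simp add: k field_simps)
    then have "k * ?c q < 2 * card (nat_residues Q X)"
      by (metis of_nat_less_iff of_nat_mult of_nat_numeral)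
    with 1 Q(4) show False by linarith
  qed
qed

text \<open>A finite intersection could be discarded as an exceptional set. That frees one class
  modulo \<open>m * q\<close>, and the remaining classes would cover the rest of \<open>Y\<close>
  with density below the one given by \<open>dens\<close>.\<close>

lemma infinite_progression_Int:
  assumes q: "0 < q" and m: "1 \<le> m"
    and dens: "upper_buck_density Y = real (card (nat_residues q Y)) / real q"
    and c: "c mod q \<in> nat_residues q Y"
  shows "infinite (progression c (m * q) \<inter> Y)"
proof
  assume fin: "finite (progression c (m * q) \<inter> Y)"
  have mq: "0 < m * q" using q m by simp
  \<comment> \<open>The progression starts at \<open>c\<close>, so smaller elements of its class are
    discarded as well.\<close>
  define F where "F = progression c (m * q) \<inter> Y \<union> {..<c}"
  let ?S = "{x \<in> {..<m * q}. x mod q \<in> nat_residues q Y}"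
  have cS: "c mod (m * q) \<in> ?S" using mq c by (simp add: mod_mod_cancel)
  have "nat_residues (m * q) (Y - F) \<subseteq> ?S - {c mod (m * q)}"
  proof
    fix x assume "x \<in> nat_residues (m * q) (Y - F)"
    then obtain y where y: "y \<in> Y" "y \<notin> F" "x = y mod (m * q)" by (auto simp: nat_residues_def)
    then have "c \<le> y" "y \<notin> progression c (m * q)" by (auto simp: F_def)
    then have "x \<noteq> c mod (m * q)" using y(3) progression_eq[OF mq] by auto
    moreover have "x \<in> ?S" using y mq by (simp add: mod_mod_cancel nat_residues_def)
    ultimately show "x \<in> ?S - {c mod (m * q)}" by blast
  qed
  then have "card (nat_residues (m * q) (Y - F)) \<le> card (?S - {c mod (m * q)})"
    by (intro card_mono) auto
  also have "\<dots> < card ?S" using cS by (intro card_Diff1_less) auto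
  also have "\<dots> = m * card (nat_residues q Y)" by (rule card_mod_multiple[OF q nat_residues_subset[OF q]])
  finally have "real (card (nat_residues (m * q) (Y - F))) < real m * real (card (nat_residues q Y))"
    by (metis of_nat_less_iff of_nat_mult)
  then have "real (card (nat_residues (m * q) (Y - F))) / real (m * q) < real (card (nat_residues q Y)) / real q"
    using q m by (simp add: field_simps)
  moreover have "upper_buck_density Y \<le> real (card (nat_residues (m * q) (Y - F))) / real (m * q)"
    using fin by (intro upper_buck_density_le[OF mq]) (simp add: F_def)
  ultimately show False using dens by linarith
qed

text \<open>A union of progressions of difference \<open>p\<close> is closed under adding
  \<open>p\<close>, so \<open>p\<close> is a period of \<open>A + A\<close> modulo \<open>q\<close>
  and thus a multiple of \<open>q\<close>.\<close>

lemma minimal_modulus_aperiodic: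
  assumes q: "0 < q" and A: "union_of_progressions q A"
    and aper: "\<not> periodic_set (integer_mod_group q) (residues_mod q (A + A))"
  shows "minimal_modulus q A"
  unfolding minimal_modulus_def
proof (intro conjI allI impI)
  fix p assume p: "0 < p \<and> union_of_progressions p A"
  then have shift: "x + p \<in> A" if "x \<in> A" for x
    using that by (auto simp: union_of_progressions_def progression_eq)
  have "period q (A + A) p" unfolding period_def
  proof (intro allI impI)
    fix z assume "z mod q \<in> nat_residues q (A + A)"
    then obtain w where "w \<in> A + A" "z mod q = w mod q" by (auto simp: nat_residues_def)
    then obtain x y where xy: "x \<in> A" "y \<in> A" "z mod q = (x + y) mod q" by (metis set_plus_elim)
    then have "(z + p) mod q = ((x + p) + y) mod q" by (metis add.assoc add.commute mod_add_left_eq)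
    moreover have "(x + p) + y \<in> A + A" using shift xy by blast
    ultimately show "(z + p) mod q \<in> nat_residues q (A + A)" by (simp add: nat_residues_def)
  qed
  then have "q dvd p" by (rule aperiodic_dvd_period[OF q aper])
  then show "q \<le> p" using p by (simp add: dvd_imp_le)
qed (use q A in auto)

theorem theorem1p2:
  fixes X :: "nat set"
  assumes "upper_buck_density (X + X) < 2 * upper_buck_density X"
  shows "\<exists>(q::nat) (r::nat) (a :: nat \<Rightarrow> nat) (A :: nat set).
    q > 0 \<and>
    A = (\<Union>j\<in>{1..r}. progression (a j) q) \<and> A \<in> buck_family \<and>
    (let G = integer_mod_group q;
         AA = residues_mod q A <#>\<^bsub>G\<^esub> residues_mod q A;
         XX = residues_mod q X <#>\<^bsub>G\<^esub> residues_mod q X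
     in
       (minimal_modulus q A \<and> \<not> periodic_set G AA) \<and>
       (X \<subseteq> A \<and> residues_mod q X = residues_mod q A \<and>
        card (residues_mod q X) = r \<and> r \<ge> 1 \<and> card XX = 2 * r - 1) \<and>
       (r = 1 \<longrightarrow> (\<exists>b\<in>carrier G. residues_mod q X = {b} \<and> XX = {b \<otimes>\<^bsub>G\<^esub> b})) \<and>
       (r \<ge> 2 \<longrightarrow>
          quasi_periodic_set G XX \<or>
          (\<not> quasi_periodic_set G XX \<and> arith_progression G XX \<and>
           arith_progression G (residues_mod q X))) \<and>
       (\<forall>m::nat. m \<ge> 1 \<longrightarrow>
          (\<forall>i\<in>{1..r}. \<forall>j\<in>{1..r}. \<forall>h\<in>{0..m-1}.
             infinite (progression (a i + a j + h * q) (m * q) \<inter> (X + X)))) \<and>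
       upper_buck_density (X + X) = (2 * real r - 1) / real q \<and>
       real r / real q - 1 / (2 * real q) < upper_buck_density X \<and>
       upper_buck_density X \<le> real r / real q)"
proof -
  obtain m where m: "0 < m" "real (card (nat_residues m (X + X))) / real m < 2 * upper_buck_density X"
    using ex_modulus_less[OF assms] .
  obtain q where q: "0 < q"
    and aper: "\<not> periodic_set (integer_mod_group q) (residues_mod q (X + X))"
    and eq: "real (card (nat_residues q (X + X))) / real q = real (card (nat_residues m (X + X))) / real m"
    and card: "card (nat_residues q (X + X)) + 1 = 2 * card (nat_residues q X)"
    using ex_critical_modulus[OF m] by metis
  have less: "real (card (nat_residues q (X + X))) / real q < 2 * upper_buck_density X"
    using eq m(2) by simp
  note dens = upper_buck_density_sumset[OF q aper less]
  define r where "r = card (nat_residues q X)"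
  have "finite (nat_residues q X)" using nat_residues_subset[OF q] finite_subset by blast
  then obtain a where a: "bij_betw a {1..r} (nat_residues q X)"
    unfolding r_def using ex_bij_betw_nat_finite_1 by blast
  then have a_image: "a ` {1..r} = nat_residues q X" by (simp add: bij_betw_def)
  \<comment> \<open>The \<open>a j\<close> are the residues themselves, hence below
    \<open>q\<close>; so each progression is a whole residue class of the natural numbers, and
    \<open>A\<close> contains \<open>X\<close>.\<close>
  define A where "A = (\<Union>j\<in>{1..r}. progression (a j) q)"
  have a_mod: "a j mod q = a j" "a j \<in> nat_residues q X" if "j \<in> {1..r}" for j
  proof -
    show *: "a j \<in> nat_residues q X" using a_image that by blast
    then show "a j mod q = a j" using nat_residues_subset[OF q, of X] by auto
  qed
  have A_iff: "x \<in> A \<longleftrightarrow> x mod q \<in> nat_residues q X" for x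
  proof -
    have "x \<in> A \<longleftrightarrow> (\<exists>j\<in>{1..r}. a j \<le> x \<and> x mod q = a j)"
      unfolding A_def progression_eq[OF q] using a_mod(1) by auto
    also have "\<dots> \<longleftrightarrow> (\<exists>j\<in>{1..r}. x mod q = a j)" by (metis mod_less_eq_dividend)
    also have "\<dots> \<longleftrightarrow> x mod q \<in> nat_residues q X" unfolding a_image[symmetric] by blast
    finally show ?thesis .
  qed
  have XA: "X \<subseteq> A" unfolding subset_iff A_iff by (simp add: nat_residues_def)
  have res_nat: "nat_residues q A = nat_residues q X"
  proof
    show "nat_residues q A \<subseteq> nat_residues q X" using A_iff by (auto simp: nat_residues_def[of q A])
    show "nat_residues q X \<subseteq> nat_residues q A" using XA by (auto simp: nat_residues_def)
  qed
  then have res: "residues_mod q X = residues_mod q A" by (simp add: residues_mod_eq)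
  let ?G = "integer_mod_group q"
  have XX: "residues_mod q X <#>\<^bsub>?G\<^esub> residues_mod q X = residues_mod q (X + X)"
    by (rule residues_mod_sumset[OF q, symmetric])
  have AA: "residues_mod q A <#>\<^bsub>?G\<^esub> residues_mod q A = residues_mod q (X + X)"
    unfolding res[symmetric] by (rule XX)
  have fam: "A \<in> buck_family" unfolding buck_family_def A_def
    by (intro CollectI exI[of _ r] exI[of _ a] exI[of _ "\<lambda>_. q"]) simp
  have min: "minimal_modulus q A"
  proof (rule minimal_modulus_aperiodic[OF q])
    show "union_of_progressions q A" unfolding union_of_progressions_def A_def by blast
    show "\<not> periodic_set ?G (residues_mod q (A + A))"
      using aper unfolding residues_mod_sumset[OF q, of A A] AA .
  qed
  have card_res: "card (residues_mod q X) = r" by (simp add: card_residues_mod r_def)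
  have r: "1 \<le> r" "card (residues_mod q (X + X)) = 2 * r - 1"
    "real (card (nat_residues q (X + X))) = 2 * real r - 1"
    using card by (simp_all add: card_residues_mod r_def)
  have single: "\<exists>b\<in>carrier ?G. residues_mod q X = {b} \<and> residues_mod q (X + X) = {b \<otimes>\<^bsub>?G\<^esub> b}" if "r = 1"
  proof -
    obtain b where b: "residues_mod q X = {b}" using card_res \<open>r = 1\<close> by (metis card_1_singletonE)
    then have "b \<in> carrier ?G" using residues_mod_subset[OF q, of X] q by (simp add: carrier_integer_mod_group)
    moreover have "residues_mod q (X + X) = {b \<otimes>\<^bsub>?G\<^esub> b}"
      unfolding XX[symmetric] b by (simp add: set_mult_def)
    ultimately show ?thesis using b by blast
  qed
  have kemperman: "quasi_periodic_set ?G (residues_mod q (X + X)) \<or>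
      arith_progression ?G (residues_mod q (X + X)) \<and> arith_progression ?G (residues_mod q X)" if "2 \<le> r"
  proof -
    have "residues_mod q X \<noteq> {}" using card_res that by auto
    from quasi_periodic_set_or_arith_progression[OF q residues_mod_subset[OF q] this]
    show ?thesis unfolding XX using aper that card_res r by simp
  qed
  have inf: "infinite (progression (a i + a j + h * q) (k * q) \<inter> (X + X))"
    if k: "1 \<le> k" and i: "i \<in> {1..r}" and j: "j \<in> {1..r}" for i j h k
  proof (rule infinite_progression_Int[OF q k dens])
    obtain x where "x \<in> X" "a i = x mod q" using a_mod(2)[OF i] unfolding nat_residues_def by blast
    moreover obtain y where "y \<in> X" "a j = y mod q" using a_mod(2)[OF j] unfolding nat_residues_def by blast
    ultimately have "x + y \<in> X + X" "(a i + a j + h * q) mod q = (x + y) mod q"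
      by (auto simp: mod_add_eq)
    then show "(a i + a j + h * q) mod q \<in> nat_residues q (X + X)" by (simp add: nat_residues_def)
  qed
  have dens_XX: "upper_buck_density (X + X) = (2 * real r - 1) / real q" using dens r(3) by simp
  \<comment> \<open>This is \<open>less\<close> with 2r - 1 residues, halved.\<close>
  have lower: "real r / real q - 1 / (2 * real q) < upper_buck_density X"
    using less q unfolding r(3) by (simp add: field_simps)
  have upper: "upper_buck_density X \<le> real r / real q"
    using upper_buck_density_le[OF q, of "{}" X] by (simp add: r_def)
  show ?thesis
  proof (rule exI[of _ q], rule exI[of _ r], rule exI[of _ a], rule exI[of _ A],
      unfold Let_def XX AA, intro conjI impI allI ballI)
    assume "2 \<le> r"
    then show "quasi_periodic_set ?G (residues_mod q (X + X)) \<or>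
        \<not> quasi_periodic_set ?G (residues_mod q (X + X)) \<and>
        arith_progression ?G (residues_mod q (X + X)) \<and> arith_progression ?G (residues_mod q X)"
      using kemperman by blast
  qed (rule q A_def fam min aper XA res card_res r single inf dens_XX lower upper; assumption)+
qed

end
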